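(* Let $G\in\mathbf{B}^+(\mathcal H)$ and $F_0\in\mathbf{B}^+(\mathcal H)$, let $F_n=\mu_G(F_{n-1})$ for $n\ge 1$, and let $F=\text{s-}\lim_{n\to\infty}F_n$. Define the subspaces $$\mathfrak M=\mathcal H\ominus\mathrm{clos}\left\{f\in\mathcal H:(G+F_0)^{1/2}f\in\mathrm{ran}\,G^{1/2}\right\},$$ $$\mathfrak N=\mathcal H\ominus\mathrm{clos}\left\{g\in\mathcal H:F_0^{1/2}g\in\mathrm{ran}\,G^{1/2}\right\}.$$ Then $$F=(G+F_0)^{1/2}P_{\mathfrak M}(G+F_0)^{1/2}\qquad\text{and}\qquad F=F_0^{1/2}P_{\mathfrak N}F_0^{1/2}.$$
   Context: $\mathcal H$ is a complex Hilbert space; $\mathbf{B}^+(\mathcal H)$ is the cone of all bounded nonnegative self-adjoint operators in $\mathcal H$. For a closed subspace $\mathcal K$, $P_{\mathcal K}$ is the orthogonal projection onto $\mathcal K$. For $X,G\in\mathbf{B}^+(\mathcal H)$ the parallel sum $X:G\in\mathbf{B}^+(\mathcal H)$ is the operator with quadratic form $((X:G)h,h)=\inf\{(Xf,f)+(Gg,g): f,g\in\mathcal H,\ h=f+g\}$. The mapping $\mu_G:\mathbf{B}^+(\mathcal H)\to\mathbf{B}^+(\mathcal H)$ is $\mu_G(X)=X-X:G$; it satisfies $0\le\mu_G(X)\le X$, so the sequence $\{F_n\}$ is non-increasing and its strong limit ($\text{s-}\lim$) exists in $\mathbf{B}^+(\mathcal H)$. *)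

theory Defs
  imports "HOL-Analysis.Analysis"
begin

text \<open>
  Complex inner product spaces.  The class extends \<^class>\<open>real_inner\<close>, so that the library's norm
  and topology are available; the axiom \<open>Re_cinner\<close> says that the real inner product of
  \<^class>\<open>real_inner\<close> is the real part of the complex one.  Consequently the norm is
  \<open>norm x = sqrt (Re (cinner x x))\<close>, and positive definiteness is inherited.
  The inner product is linear in its first argument.
\<close>

class complex_inner = real_inner +
  fixes scaleC :: "complex \<Rightarrow> 'a \<Rightarrow> 'a"  (infixr "*\<^sub>C" 75)
    and cinner :: "'a \<Rightarrow> 'a \<Rightarrow> complex"
  assumes scaleC_add_right: "c *\<^sub>C (x + y) = c *\<^sub>C x + c *\<^sub>C y"
    and scaleC_add_left: "(c + d) *\<^sub>C x = c *\<^sub>C x + d *\<^sub>C x"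
    and scaleC_scaleC: "c *\<^sub>C (d *\<^sub>C x) = (c * d) *\<^sub>C x"
    and scaleC_of_real: "complex_of_real r *\<^sub>C x = r *\<^sub>R x"
    and cinner_commute: "cinner x y = cnj (cinner y x)"
    and cinner_add_left: "cinner (x + y) z = cinner x z + cinner y z"
    and cinner_scaleC_left: "cinner (c *\<^sub>C x) y = c * cinner x y"
    and Re_cinner: "Re (cinner x y) = inner x y"

class complex_hilbert = complex_inner + complete_space

instantiation complex :: complex_hilbert
begin

definition scaleC_complex :: "complex \<Rightarrow> complex \<Rightarrow> complex"
  where "scaleC_complex c x = c * x"

definition cinner_complex :: "complex \<Rightarrow> complex \<Rightarrow> complex"
  where "cinner_complex x y = x * cnj y"

instance
  by standard
    (simp_all add: scaleC_complex_def cinner_complex_def algebra_simps inner_complex_def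
      scaleR_conv_of_real)

end

definition bounded_clinear :: "('a::complex_inner \<Rightarrow> 'a) \<Rightarrow> bool"
  where "bounded_clinear T \<longleftrightarrow> bounded_linear T \<and> (\<forall>c x. T (c *\<^sub>C x) = c *\<^sub>C T x)"

text \<open>The quadratic form of \<open>T\<close>; for self-adjoint \<open>T\<close> the number \<open>cinner (T x) x\<close> is real.\<close>

definition qform :: "('a::complex_inner \<Rightarrow> 'a) \<Rightarrow> 'a \<Rightarrow> real"
  where "qform T x = Re (cinner (T x) x)"

definition pos_ops :: "('a::complex_inner \<Rightarrow> 'a) set"
  where "pos_ops = {T. bounded_clinear T \<and> (\<forall>x y. cinner (T x) y = cinner x (T y))
                       \<and> (\<forall>x. 0 \<le> qform T x)}"

definition op_sqrt :: "('a::complex_hilbert \<Rightarrow> 'a) \<Rightarrow> 'a \<Rightarrow> 'a"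
  where "op_sqrt T = (THE S. S \<in> pos_ops \<and> S \<circ> S = T)"

definition orth_complement :: "'a::complex_inner set \<Rightarrow> 'a set"
  where "orth_complement K = {x. \<forall>y\<in>K. cinner x y = 0}"

text \<open>Orthogonal projection onto a closed subspace \<open>K\<close> of a Hilbert space.\<close>

definition orth_proj :: "'a::complex_hilbert set \<Rightarrow> 'a \<Rightarrow> 'a"
  where "orth_proj K x = (THE y. y \<in> K \<and> x - y \<in> orth_complement K)"

definition parallel_sum :: "('a::complex_hilbert \<Rightarrow> 'a) \<Rightarrow> ('a \<Rightarrow> 'a) \<Rightarrow> 'a \<Rightarrow> 'a"
  where "parallel_sum X G = (THE T. T \<in> pos_ops \<and>
           (\<forall>h. qform T h = Inf {qform X f + qform G g | f g. h = f + g}))"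

definition mu :: "('a::complex_hilbert \<Rightarrow> 'a) \<Rightarrow> ('a \<Rightarrow> 'a) \<Rightarrow> 'a \<Rightarrow> 'a"
  where "mu G X = (\<lambda>x. X x - parallel_sum X G x)"

definition strong_lim :: "(nat \<Rightarrow> 'a::complex_hilbert \<Rightarrow> 'a) \<Rightarrow> 'a \<Rightarrow> 'a"
  where "strong_lim T = (\<lambda>x. lim (\<lambda>n. T n x))"

end

theory Submission
  imports Defs
begin

text \<open>
  Let \<open>T\<^sup>2 = F\<^sub>0 + t G\<close> with \<open>T \<ge> 0\<close> and \<open>t \<ge> 0\<close>, let \<open>S = G\<^sup>1\<^sup>/\<^sup>2\<close>, and let \<open>L\<close> be the closure of the
  range of \<open>J h = (T h, S h)\<close> in \<open>H \<times> H\<close>. If \<open>K\<close> is the compression to \<open>L\<close> of the projection onto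
  the second component, then \<open>G = J* K J\<close> and \<open>F\<^sub>0 = J* (1 - (1 + t) K) J\<close>. Hence
  \<open>F\<^sub>n = J* X\<^sub>n J\<close>, where \<open>X\<^sub>0 = 1 - (1 + t) K\<close> and \<open>X\<^sub>n\<^sub>+\<^sub>1 = X\<^sub>n (X\<^sub>n + K)\<^sup>-\<^sup>1 X\<^sub>n\<close> commute with \<open>K\<close>; the
  inverses are bounded because \<open>X\<^sub>n\<^sub>+\<^sub>1 + K \<ge> (3/4) (X\<^sub>n + K)\<close>. The decreasing sequence \<open>X\<^sub>n\<close> converges
  strongly to the projection onto the kernel of \<open>K\<close>. The vectors of \<open>L\<close> in this kernel are the pairs
  \<open>(y, 0) \<in> L\<close>, and these are exactly the pairs with \<open>y\<close> orthogonal to every \<open>f\<close> such that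
  \<open>T f \<in> ran S\<close>. This gives \<open>F = T P T\<close> with the projection \<open>P\<close> onto the space of such \<open>y\<close>;
  the two formulas are the cases \<open>t = 1\<close> and \<open>t = 0\<close>.
\<close>

section \<open>Positive operators on real inner product spaces\<close>

text \<open>Positivity refers to the real inner product, so that one theory serves both H and the
  product H x H. Complex linearity is recovered later as commutation with multiplication by
  \<open>\<i>\<close>.\<close>

definition psd :: "('a::real_inner \<Rightarrow> 'a) \<Rightarrow> bool"
  where "psd T \<longleftrightarrow> bounded_linear T \<and> (\<forall>x y. T x \<bullet> y = x \<bullet> T y) \<and> (\<forall>x. 0 \<le> T x \<bullet> x)"

lemma psdI:
  assumes "bounded_linear T" "\<And>x y. T x \<bullet> y = x \<bullet> T y" "\<And>x. 0 \<le> T x \<bullet> x"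
  shows "psd T"
  using assms by (simp add: psd_def)

lemma psd_bounded_linear: "psd T \<Longrightarrow> bounded_linear T"
  and psd_sym: "psd T \<Longrightarrow> T x \<bullet> y = x \<bullet> T y"
  and psd_nonneg: "psd T \<Longrightarrow> 0 \<le> T x \<bullet> x"
  by (auto simp: psd_def)

lemma psd_linear: "psd T \<Longrightarrow> linear T"
  by (simp add: psd_bounded_linear bounded_linear.linear)

text \<open>The form of \<open>T\<close> at \<open>x + r *\<^sub>R y\<close> is a polynomial of
  degree at most two in \<open>r\<close> that is nowhere negative.\<close>

lemma psd_Cauchy_Schwarz:
  assumes T: "psd T"
  shows "(T x \<bullet> y)\<^sup>2 \<le> (T x \<bullet> x) * (T y \<bullet> y)"
proof -
  note lin = linear_add[OF psd_linear[OF T]] linear_scale[OF psd_linear[OF T]]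
  have q: "0 \<le> T x \<bullet> x + 2 * r * (T x \<bullet> y) + r\<^sup>2 * (T y \<bullet> y)" for r
  proof -
    have "T y \<bullet> x = T x \<bullet> y" 
      using psd_sym[OF T, of y x] inner_commute[of y "T x"] by simp
    then have "T (x + r *\<^sub>R y) \<bullet> (x + r *\<^sub>R y)
        = T x \<bullet> x + 2 * r * (T x \<bullet> y) + r\<^sup>2 * (T y \<bullet> y)"
      unfolding lin
      by (simp add: inner_add_left inner_add_right power2_eq_square distrib_left)
    then show ?thesis
      using psd_nonneg[OF T, of "x + r *\<^sub>R y"] by simp
  qed
  show ?thesis
  proof (cases "T y \<bullet> y = 0")
    case True
    have "T x \<bullet> y = 0"
    proof (rule ccontr)
      assume "T x \<bullet> y \<noteq> 0"
      then show False
        \<comment> \<open>Here the polynomial is affine, and this choice of \<open>r\<close> gives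
          it the value -1.\<close>
        using q[of "- (T x \<bullet> x + 1) / (2 * (T x \<bullet> y))"] True by (simp add: field_simps)
    qed
    then show ?thesis using True by simp
  next
    case False
    then have pos: "0 < T y \<bullet> y" using psd_nonneg[OF T, of y] by simp
    have "0 \<le> T x \<bullet> x - (T x \<bullet> y)\<^sup>2 / (T y \<bullet> y)"
      using q[of "- (T x \<bullet> y) / (T y \<bullet> y)"] pos
      by (simp add: power2_eq_square field_simps)
    then show ?thesis using pos by (simp add: field_simps)
  qed
qed

text \<open>Cauchy-Schwarz with \<open>y = T x\<close>, after cancelling one factor
  \<open>(norm (T x))\<^sup>2\<close>. This converts convergence of forms into convergence of
  vectors.\<close>

lemma psd_norm_square_le:
  assumes T: "psd T" and c: "\<And>x. T x \<bullet> x \<le> c * (norm x)\<^sup>2"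
  shows "(norm (T x))\<^sup>2 \<le> c * (T x \<bullet> x)"
proof (cases "T x = 0")
  case True
  then show ?thesis by simp
next
  case False
  have "((norm (T x))\<^sup>2)\<^sup>2 \<le> (T x \<bullet> x) * (T (T x) \<bullet> T x)"
    using psd_Cauchy_Schwarz[OF T, of x "T x"] by (simp add: power2_norm_eq_inner)
  also have "\<dots> \<le> (T x \<bullet> x) * (c * (norm (T x))\<^sup>2)"
    by (intro mult_left_mono c psd_nonneg T)
  finally have "(norm (T x))\<^sup>2 * (norm (T x))\<^sup>2 \<le> (c * (T x \<bullet> x)) * (norm (T x))\<^sup>2"
    by (simp only: power2_eq_square ac_simps)
  moreover have "0 < (norm (T x))\<^sup>2" using False by simp
  ultimately show ?thesis by (rule mult_right_le_imp_le)
qed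

lemma psd_contraction:
  assumes T: "psd T" and le: "\<And>x. T x \<bullet> x \<le> (norm x)\<^sup>2"
  shows "norm (T x) \<le> norm x"
proof -
  have "(norm (T x))\<^sup>2 \<le> (norm x)\<^sup>2"
    using psd_norm_square_le[OF T, of 1 x] le by (simp add: order_trans[OF _ le])
  then show ?thesis by (rule power2_le_imp_le) simp
qed

lemma psd_eq_0:
  assumes T: "psd T" and 0: "T x \<bullet> x = 0"
  shows "T x = 0"
  using psd_Cauchy_Schwarz[OF T, of x "T x"] 0 by simp

lemma psd_bounded_above:
  assumes "psd T"
  obtains c where "0 < c" "\<And>x. T x \<bullet> x \<le> c * (norm x)\<^sup>2"
proof -
  obtain c where c: "0 < c" "\<And>x. norm (T x) \<le> norm x * c"
    using bounded_linear.pos_bounded[OF psd_bounded_linear[OF assms]] by blast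
  have "T x \<bullet> x \<le> c * (norm x)\<^sup>2" for x
  proof -
    have "T x \<bullet> x \<le> norm (T x) * norm x" by (rule norm_cauchy_schwarz)
    also have "\<dots> \<le> (norm x * c) * norm x" by (intro mult_right_mono c) simp
    finally show ?thesis by (simp add: power2_eq_square ac_simps)
  qed
  then show ?thesis using c that by blast
qed

lemma psd_id: "psd (\<lambda>x. x)"
  by (rule psdI) (auto simp: bounded_linear_ident)

lemma psd_add: "psd T \<Longrightarrow> psd U \<Longrightarrow> psd (\<lambda>x. T x + U x)"
  by (rule psdI)
    (auto simp: psd_def bounded_linear_add inner_add_left inner_add_right)

lemma psd_scaleR: "psd T \<Longrightarrow> 0 \<le> a \<Longrightarrow> psd (\<lambda>x. a *\<^sub>R T x)"
  by (rule psdI)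
    (auto simp: psd_def bounded_linear_compose[OF bounded_linear_scaleR_right])

lemma psd_diff:
  assumes "psd T" "psd U" "\<And>x. U x \<bullet> x \<le> T x \<bullet> x"
  shows "psd (\<lambda>x. T x - U x)"
  using assms
  by (intro psdI)
    (auto simp: psd_bounded_linear psd_sym bounded_linear_sub inner_diff_left inner_diff_right)

text \<open>\<open>R'\<close> is the adjoint of \<open>R\<close>. The two spaces may differ, as is
  the case for \<open>J\<close> below.\<close>

lemma psd_conj:
  assumes R: "bounded_linear R" "bounded_linear R'" and adj: "\<And>x y. R x \<bullet> y = x \<bullet> R' y"
    and T: "psd T"
  shows "psd (\<lambda>x. R' (T (R x)))"
proof (rule psdI)
  show "bounded_linear (\<lambda>x. R' (T (R x)))"
    by (intro bounded_linear_compose[OF R(2)] bounded_linear_compose[OF psd_bounded_linear[OF T]] R(1))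
  have adj': "R' y \<bullet> x = y \<bullet> R x" for x y
    using adj[of x y] by (simp add: inner_commute)
  show "R' (T (R x)) \<bullet> y = x \<bullet> R' (T (R y))" for x y
    using adj[of x "T (R y)"] by (simp add: adj' psd_sym[OF T])
  show "0 \<le> R' (T (R x)) \<bullet> x" for x
    using psd_nonneg[OF T, of "R x"] by (simp add: adj')
qed

section \<open>Strong limits of monotone sequences\<close>

text \<open>The forms decrease and are bounded below, hence are Cauchy. For \<open>m \<le> n\<close>
  the difference \<open>X m - X n\<close> lies between 0 and the identity, so
  \<open>psd_norm_square_le\<close> makes the vectors Cauchy as well.\<close>

lemma psd_limit:
  fixes X :: "nat \<Rightarrow> 'a::{real_inner,complete_space} \<Rightarrow> 'a"
  assumes X: "\<And>n. psd (X n)"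
    and dec: "\<And>n x. X (Suc n) x \<bullet> x \<le> X n x \<bullet> x"
    and le: "\<And>x. X 0 x \<bullet> x \<le> (norm x)\<^sup>2"
  obtains L where "psd L" "\<And>x. (\<lambda>n. X n x) \<longlonglongrightarrow> L x"
    "\<And>n x. X n x \<bullet> x \<le> (norm x)\<^sup>2"
proof -
  have dec': "X n x \<bullet> x \<le> X m x \<bullet> x" if "m \<le> n" for m n x
    using lift_Suc_antimono_le[of "\<lambda>n. X n x \<bullet> x"] dec that by blast
  have le': "X n x \<bullet> x \<le> (norm x)\<^sup>2" for n x
    using dec'[of 0 n x] le[of x] by simp
  have conv: "convergent (\<lambda>n. X n x)" for x
  proof -
    have mono: "decseq (\<lambda>n. X n x \<bullet> x)"
      using dec by (simp add: decseq_Suc_iff)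
    have "Cauchy (\<lambda>n. X n x \<bullet> x)"
      using decseq_convergent[OF mono, of 0] psd_nonneg[OF X]
      by (metis LIMSEQ_imp_Cauchy)
    have "Cauchy (\<lambda>n. X n x)"
    proof (rule CauchyI)
      fix e :: real assume "0 < e"
      then obtain M where M: "\<And>m n. m \<ge> M \<Longrightarrow> n \<ge> M \<Longrightarrow> norm (X m x \<bullet> x - X n x \<bullet> x) < e\<^sup>2"
        using CauchyD[OF \<open>Cauchy (\<lambda>n. X n x \<bullet> x)\<close>, of "e\<^sup>2"] by auto
      have *: "norm (X m x - X n x) < e" if "m \<ge> M" "n \<ge> m" for m n
      proof -
        let ?D = "\<lambda>x. X m x - X n x"
        have D: "psd ?D" using that by (intro psd_diff X dec')
        have "?D y \<bullet> y \<le> 1 * (norm y)\<^sup>2" for y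
          using le'[of m y] psd_nonneg[OF X, of n y] by (simp add: inner_diff_left)
        from psd_norm_square_le[OF D this, of x]
        have "(norm (X m x - X n x))\<^sup>2 \<le> X m x \<bullet> x - X n x \<bullet> x"
          by (simp add: inner_diff_left)
        also have "\<dots> < e\<^sup>2" using M[of m n] that by simp
        finally show ?thesis using \<open>0 < e\<close> by (simp add: power2_less_imp_less)
      qed
      have "norm (X m x - X n x) < e" if "m \<ge> M" "n \<ge> M" for m n
        using *[of m n] *[of n m] that by (cases "m \<le> n") (auto simp: norm_minus_commute)
      then show "\<exists>M. \<forall>m\<ge>M. \<forall>n\<ge>M. norm (X m x - X n x) < e" by blast
    qed
    then show ?thesis by (simp add: Cauchy_convergent_iff)
  qed
  define L where "L x = lim (\<lambda>n. X n x)" for x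
  have lim: "(\<lambda>n. X n x) \<longlonglongrightarrow> L x" for x
    using conv unfolding L_def by (simp add: convergent_LIMSEQ_iff)
  have norm_le: "norm (X n x) \<le> norm x" for n x
    by (rule psd_contraction[OF X le'])
  have "psd L"
  proof (rule psdI)
    show "bounded_linear L"
    proof (rule bounded_linear_intro[where K = 1])
      fix x y
      have "(\<lambda>n. X n (x + y)) \<longlonglongrightarrow> L x + L y"
        by (simp add: linear_add[OF psd_linear[OF X]] tendsto_add lim)
      then show "L (x + y) = L x + L y" by (rule LIMSEQ_unique[OF lim])
    next
      fix r x
      have "(\<lambda>n. X n (r *\<^sub>R x)) \<longlonglongrightarrow> r *\<^sub>R L x"
        by (simp add: linear_scale[OF psd_linear[OF X]] tendsto_scaleR lim)
      then show "L (r *\<^sub>R x) = r *\<^sub>R L x" by (rule LIMSEQ_unique[OF lim])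
    next
      fix x
      show "norm (L x) \<le> norm x * 1"
        using LIMSEQ_le_const2[OF tendsto_norm[OF lim]] norm_le by simp
    qed
  next
    fix x y
    have "(\<lambda>n. X n x \<bullet> y) \<longlonglongrightarrow> L x \<bullet> y" "(\<lambda>n. x \<bullet> X n y) \<longlonglongrightarrow> x \<bullet> L y"
      by (intro tendsto_intros lim)+
    then show "L x \<bullet> y = x \<bullet> L y"
      using LIMSEQ_unique by (simp add: psd_sym[OF X]) blast
  next
    fix x
    have "(\<lambda>n. X n x \<bullet> x) \<longlonglongrightarrow> L x \<bullet> x" by (intro tendsto_intros lim)
    then show "0 \<le> L x \<bullet> x" by (rule LIMSEQ_le_const) (auto simp: psd_nonneg[OF X])
  qed
  then show ?thesis using that lim le' by blast
qed

text \<open>The uniform bound controls \<open>X n (y n - z)\<close>. With \<open>y n = X n x\<close>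
  this shows that products of strongly convergent contractions converge strongly.\<close>

lemma tendsto_contractions:
  fixes X :: "nat \<Rightarrow> 'a::real_normed_vector \<Rightarrow> 'a"
  assumes "\<And>n. linear (X n)" "\<And>n x. norm (X n x) \<le> norm x"
    and "\<And>x. (\<lambda>n. X n x) \<longlonglongrightarrow> L x" "y \<longlonglongrightarrow> z"
  shows "(\<lambda>n. X n (y n)) \<longlonglongrightarrow> L z"
proof -
  have "(\<lambda>n. y n - z) \<longlonglongrightarrow> 0" using assms(4) by (simp add: LIM_zero)
  then have "(\<lambda>n. X n (y n - z)) \<longlonglongrightarrow> 0"
    by (rule tendsto_0_le[where K = 1]) (simp add: assms(2))
  from tendsto_add[OF this assms(3)[of z]] show ?thesis
    by (simp add: linear_diff[OF assms(1)])
qed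

section \<open>Square roots\<close>

text \<open>These are the polynomials in \<open>B\<close> with nonnegative coefficients. For them
  positivity of a product follows from positivity of the powers of \<open>B\<close>, before square
  roots are at hand.\<close>

inductive psd_poly :: "('a::real_inner \<Rightarrow> 'a) \<Rightarrow> ('a \<Rightarrow> 'a) \<Rightarrow> bool" for B
  where
    one: "psd_poly B (\<lambda>x. x)"
  | shift: "psd_poly B X \<Longrightarrow> psd_poly B (\<lambda>x. B (X x))"
  | add: "psd_poly B X \<Longrightarrow> psd_poly B Y \<Longrightarrow> psd_poly B (\<lambda>x. X x + Y x)"
  | scale: "psd_poly B X \<Longrightarrow> 0 \<le> a \<Longrightarrow> psd_poly B (\<lambda>x. a *\<^sub>R X x)"

lemma psd_poly_comp: "psd_poly B X \<Longrightarrow> psd_poly B Y \<Longrightarrow> psd_poly B (\<lambda>x. X (Y x))"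
  by (induction rule: psd_poly.induct) (auto intro: psd_poly.intros)

text \<open>The power k + 2 is the conjugate of the power k by \<open>B\<close>, so the induction
  goes in steps of two.\<close>

lemma psd_power:
  assumes B: "psd B"
  shows "psd (B ^^ k)"
proof (induction k rule: less_induct)
  case (less k)
  consider "k = 0" | "k = 1" | j where "k = Suc (Suc j)"
    by (metis One_nat_def not0_implies_Suc)
  then show ?case
  proof cases
    case 1
    then show ?thesis using psd_id by (simp add: id_def)
  next
    case 2
    then show ?thesis using B by simp
  next
    case 3
    have "psd (\<lambda>x. B ((B ^^ j) (B x)))"
      by (rule psd_conj[OF psd_bounded_linear[OF B] psd_bounded_linear[OF B] psd_sym[OF B] less]) (simp add: 3)
    then show ?thesis using 3 by (simp add: o_def funpow_swap1)
  qed
qed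

lemma psd_poly_psd:
  assumes B: "psd B" and X: "psd_poly B X"
  shows "psd X"
proof -
  \<comment> \<open>The additional power of \<open>B\<close> strengthens the induction: the case
    \<open>shift\<close> only raises \<open>k\<close>.\<close>
  have "psd (\<lambda>x. (B ^^ k) (X x))" for k
    using X
  proof (induction arbitrary: k rule: psd_poly.induct)
    case one
    then show ?case using psd_power[OF B, of k] by simp
  next
    case (shift X)
    then show ?case using shift.IH[of "Suc k"] by (simp add: funpow_swap1)
  next
    case (add X Y)
    then show ?case
      by (simp add: linear_add[OF psd_linear[OF psd_power[OF B]]] psd_add)
  next
    case (scale X a)
    then show ?case
      by (simp add: linear_scale[OF psd_linear[OF psd_power[OF B]]] psd_scaleR)
  qed
  from this[of 0] show ?thesis by simp
qed

lemma psd_poly_commute: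
  assumes "linear R" "\<And>x. R (B x) = B (R x)" "psd_poly B X"
  shows "R (X x) = X (R x)"
  using assms(3)
  by (induction arbitrary: x rule: psd_poly.induct)
    (auto simp: assms(2) linear_add[OF assms(1)] linear_scale[OF assms(1)])

text \<open>With \<open>Y = 1 - S\<close> and \<open>B = 1 - T\<close>, the equation \<open>S\<^sup>2 = T\<close> becomes the fixed point equation
  \<open>Y = (B + Y\<^sup>2) / 2\<close>.\<close>

fun sqrt_iter :: "('a::real_inner \<Rightarrow> 'a) \<Rightarrow> nat \<Rightarrow> 'a \<Rightarrow> 'a"
  where
    "sqrt_iter B 0 = (\<lambda>x. 0)"
  | "sqrt_iter B (Suc n) = (\<lambda>x. (1/2) *\<^sub>R (B x + sqrt_iter B n (sqrt_iter B n x)))"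

lemma psd_poly_zero: "psd_poly B (\<lambda>x. 0)"
  using psd_poly.scale[OF psd_poly.one, of 0 B] by simp

lemma psd_poly_self: "psd_poly B B"
  using psd_poly.shift[OF psd_poly.one, of B] by simp

lemma psd_poly_sqrt_iter: "psd_poly B (sqrt_iter B n)"
proof (induction n)
  case (Suc n)
  show ?case
    using psd_poly.scale[OF psd_poly.add[OF psd_poly_self psd_poly_comp[OF Suc Suc]], of "1/2"]
    by simp
qed (simp add: psd_poly_zero)

text \<open>As the iterates commute, a difference of consecutive iterates is half the previous
  difference times the sum of the same two iterates. Hence the iterates increase.\<close>

lemma psd_poly_sqrt_iter_diff:
  assumes B: "psd B"
  shows "psd_poly B (\<lambda>x. sqrt_iter B (Suc n) x - sqrt_iter B n x)"
proof (induction n)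
  case 0
  show ?case using psd_poly.scale[OF psd_poly_self, of "1/2" B] by simp
next
  case (Suc n)
  let ?Y = "sqrt_iter B (Suc n)" and ?Z = "sqrt_iter B n"
  have lin: "linear (sqrt_iter B m)" for m
    using psd_linear psd_poly_psd[OF B psd_poly_sqrt_iter] by blast
  have comm: "sqrt_iter B m (sqrt_iter B k x) = sqrt_iter B k (sqrt_iter B m x)" for m k x
  proof (rule psd_poly_commute[OF lin _ psd_poly_sqrt_iter])
    show "sqrt_iter B m (B x) = B (sqrt_iter B m x)" for x
      by (rule psd_poly_commute[OF psd_linear[OF B] _ psd_poly_sqrt_iter, symmetric]) simp
  qed
  have "psd_poly B (\<lambda>x. (1/2) *\<^sub>R (\<lambda>x. ?Y x - ?Z x) ((\<lambda>x. ?Y x + ?Z x) x))"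
    by (rule psd_poly.scale[OF psd_poly_comp[OF Suc
            psd_poly.add[OF psd_poly_sqrt_iter psd_poly_sqrt_iter]]]) simp
  moreover have "(\<lambda>x. (1/2) *\<^sub>R (\<lambda>x. ?Y x - ?Z x) ((\<lambda>x. ?Y x + ?Z x) x))
      = (\<lambda>x. sqrt_iter B (Suc (Suc n)) x - ?Y x)"
  proof
    fix x
    have "(?Y (?Y x + ?Z x) - ?Z (?Y x + ?Z x)) = ?Y (?Y x) - ?Z (?Z x)"
      unfolding linear_add[OF lin] using comm[of "Suc n" n x] by simp
    then show "(1/2) *\<^sub>R (\<lambda>x. ?Y x - ?Z x) ((\<lambda>x. ?Y x + ?Z x) x)
      = sqrt_iter B (Suc (Suc n)) x - ?Y x"
      by (simp only: sqrt_iter.simps(2)[of B "Suc n"] sqrt_iter.simps(2)[of B n])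
        (simp add: algebra_simps)
  qed
  ultimately show ?case by simp
qed

text \<open>The operators \<open>X n = 1 - Y n\<close> decrease, and their limit is the root. The
  last conclusion, commutation with everything that commutes with \<open>T\<close>, later gives
  uniqueness and complex linearity.\<close>

lemma psd_sqrt_exists_contraction:
  fixes T :: "'a::{real_inner,complete_space} \<Rightarrow> 'a"
  assumes T: "psd T" and le: "\<And>x. T x \<bullet> x \<le> (norm x)\<^sup>2"
  obtains S where "psd S" "\<And>x. S (S x) = T x"
    "\<And>R x. bounded_linear R \<Longrightarrow> (\<And>x. R (T x) = T (R x)) \<Longrightarrow> R (S x) = S (R x)"
proof -
  define B where "B x = x - T x" for x
  define Y where "Y = sqrt_iter B"
  define X where "X n x = x - Y n x" for n x
  have B: "psd B"
    unfolding B_def using le by (intro psd_diff psd_id T) (simp add: power2_norm_eq_inner)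
  have Bx: "B x \<bullet> x \<le> (norm x)\<^sup>2" for x
    using psd_nonneg[OF T, of x] by (simp add: B_def inner_diff_left power2_norm_eq_inner)
  have Y: "psd (Y n)" for n
    unfolding Y_def by (rule psd_poly_psd[OF B psd_poly_sqrt_iter])
  have Ysuc: "Y (Suc n) x = (1/2) *\<^sub>R (B x + Y n (Y n x))" for n x
    by (simp add: Y_def)
  have Yx: "Y n x \<bullet> x \<le> (norm x)\<^sup>2" for n x
  proof (induction n arbitrary: x)
    case (Suc n)
    have "Y n (Y n x) \<bullet> x = (norm (Y n x))\<^sup>2"
      by (simp add: psd_sym[OF Y] power2_norm_eq_inner)
    also have "\<dots> \<le> (norm x)\<^sup>2"
      using psd_contraction[OF Y Suc] by (simp add: power_mono)
    finally show ?case using Bx[of x] by (simp add: Ysuc inner_add_left)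
  qed (simp add: Y_def)
  have X: "psd (X n)" for n
    unfolding X_def using Yx by (intro psd_diff psd_id Y) (simp add: power2_norm_eq_inner)
  have dec: "X (Suc n) x \<bullet> x \<le> X n x \<bullet> x" for n x
    using psd_nonneg[OF psd_poly_psd[OF B psd_poly_sqrt_iter_diff[OF B, of n]], of x]
    by (simp add: X_def Y_def inner_diff_left)
  have "X 0 x \<bullet> x \<le> (norm x)\<^sup>2" for x
    by (simp add: X_def Y_def power2_norm_eq_inner)
  from psd_limit[of X, OF X dec this] obtain S where S: "psd S"
    "\<And>x. (\<lambda>n. X n x) \<longlonglongrightarrow> S x" "\<And>n x. X n x \<bullet> x \<le> (norm x)\<^sup>2"
    by blast
  have "S (S x) = T x" for x
  proof -
    have "(\<lambda>n. X n (X n x)) \<longlonglongrightarrow> S (S x)"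
      by (rule tendsto_contractions[OF psd_linear[OF X] psd_contraction[OF X S(3)] S(2) S(2)])
    then have "(\<lambda>n. X n x + (1/2) *\<^sub>R (T x - X n (X n x))) \<longlonglongrightarrow> S x + (1/2) *\<^sub>R (T x - S (S x))"
      by (intro tendsto_intros S)
    \<comment> \<open>The recursion for \<open>Y\<close>, rewritten for \<open>X\<close>; in the
      limit the correction \<open>T - S\<^sup>2\<close> must vanish.\<close>
    moreover have "X n x + (1/2) *\<^sub>R (T x - X n (X n x)) = X (Suc n) x" for n
    proof -
      have square: "X n (X n x) = x - 2 *\<^sub>R Y n x + Y n (Y n x)"
        by (simp add: X_def linear_diff[OF psd_linear[OF Y]] scaleR_2)
      have "x - a + (1/2) *\<^sub>R (t - (x - 2 *\<^sub>R a + b)) = x - (1/2) *\<^sub>R (x - t + b)" for a b t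
      proof -
        have "2 *\<^sub>R (x - a + (1/2) *\<^sub>R (t - (x - 2 *\<^sub>R a + b))) = 2 *\<^sub>R (x - (1/2) *\<^sub>R (x - t + b))"
          by (simp add: scaleR_right_diff_distrib scaleR_right_distrib)
        then show ?thesis by simp
      qed
      then show ?thesis unfolding square unfolding X_def Ysuc B_def .
    qed
    ultimately have "(\<lambda>n. X (Suc n) x) \<longlonglongrightarrow> S x + (1/2) *\<^sub>R (T x - S (S x))" by simp
    from LIMSEQ_unique[OF this LIMSEQ_Suc[OF S(2)]] show ?thesis by simp
  qed
  moreover have "R (S x) = S (R x)"
    if R: "bounded_linear R" "\<And>x. R (T x) = T (R x)" for R x
  proof -
    note lin = bounded_linear.linear[OF R(1)]
    have "R (B x) = B (R x)" for x
      by (simp add: B_def linear_diff[OF lin] R(2))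
    then have "R (X n x) = X n (R x)" for n
      unfolding X_def Y_def
      by (simp add: linear_diff[OF lin] psd_poly_commute[OF lin _ psd_poly_sqrt_iter])
    moreover have "(\<lambda>n. R (X n x)) \<longlonglongrightarrow> R (S x)"
      by (rule bounded_linear.tendsto[OF R(1) S(2)])
    ultimately show ?thesis using LIMSEQ_unique[OF S(2)[of "R x"]] by simp
  qed
  ultimately show ?thesis using that S(1) by blast
qed

lemma psd_sqrt_exists:
  fixes T :: "'a::{real_inner,complete_space} \<Rightarrow> 'a"
  assumes T: "psd T"
  obtains S where "psd S" "\<And>x. S (S x) = T x"
    "\<And>R x. bounded_linear R \<Longrightarrow> (\<And>x. R (T x) = T (R x)) \<Longrightarrow> R (S x) = S (R x)"
proof -
  obtain c where c: "0 < c" "\<And>x. T x \<bullet> x \<le> c * (norm x)\<^sup>2"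
    using psd_bounded_above[OF T] by blast
  let ?T = "\<lambda>x. (1/c) *\<^sub>R T x"
  have "psd ?T" using c by (intro psd_scaleR T) simp
  moreover have "?T x \<bullet> x \<le> (norm x)\<^sup>2" for x
    using c by (simp add: field_simps)
  ultimately obtain S where S: "psd S" "\<And>x. S (S x) = ?T x"
    "\<And>R x. bounded_linear R \<Longrightarrow> (\<And>x. R (?T x) = ?T (R x)) \<Longrightarrow> R (S x) = S (R x)"
    using psd_sqrt_exists_contraction[of ?T] by blast
  show ?thesis
  proof (rule that[of "\<lambda>x. sqrt c *\<^sub>R S x"])
    show "psd (\<lambda>x. sqrt c *\<^sub>R S x)" using c by (intro psd_scaleR S) simp
    show "sqrt c *\<^sub>R S (sqrt c *\<^sub>R S x) = T x" for x
      using c by (simp add: linear_scale[OF psd_linear[OF S(1)]] S(2))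
    show "R (sqrt c *\<^sub>R S x) = sqrt c *\<^sub>R S (R x)"
      if "bounded_linear R" "\<And>x. R (T x) = T (R x)" for R x
      using S(3)[OF that(1)] that(2)
      by (simp add: linear_scale[OF bounded_linear.linear[OF that(1)]])
  qed
qed

text \<open>The vector \<open>y = (S - R) x\<close> is killed by \<open>S + R\<close>, since the
  roots commute and have equal squares. Both forms then vanish at \<open>y\<close>, so
  \<open>S y = R y = 0\<close>, which forces \<open>y = 0\<close>.\<close>

lemma psd_sqrt_unique:
  assumes S: "psd S" and R: "psd R" and eq: "\<And>x. R (R x) = S (S x)"
    and comm: "\<And>x. R (S x) = S (R x)"
  shows "R = S"
proof
  fix x
  define y where "y = S x - R x"
  have "S y + R y = 0"
    by (simp add: y_def linear_diff[OF psd_linear[OF S]] linear_diff[OF psd_linear[OF R]] eq comm)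
  then have "S y \<bullet> y + R y \<bullet> y = 0" by (metis inner_add_left inner_zero_left)
  then have "S y \<bullet> y = 0" "R y \<bullet> y = 0"
    using psd_nonneg[OF S, of y] psd_nonneg[OF R, of y] by auto
  then have "S y = 0" "R y = 0" by (auto intro: psd_eq_0 S R)
  have "y \<bullet> y = x \<bullet> (S y - R y)"
    by (simp add: y_def inner_diff_left inner_diff_right psd_sym[OF S] psd_sym[OF R]
        linear_diff[OF psd_linear[OF S]] linear_diff[OF psd_linear[OF R]])
  then show "R x = S x" using \<open>S y = 0\<close> \<open>R y = 0\<close> by (simp add: y_def)
qed

section \<open>Orthogonal projections and inverses\<close>

lemma subspace_closure:
  fixes S :: "'a::real_normed_vector set"
  assumes S: "subspace S"
  shows "subspace (closure S)"
proof (rule subspaceI)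
  show "0 \<in> closure S" using subspace_0[OF S] closure_subset by blast
next
  fix x y assume "x \<in> closure S" "y \<in> closure S"
  then obtain f g where "\<forall>n. f n \<in> S" "f \<longlonglongrightarrow> x" "\<forall>n. g n \<in> S" "g \<longlonglongrightarrow> y"
    unfolding closure_sequential by blast
  then show "x + y \<in> closure S"
    unfolding closure_sequential
    by (intro exI[of _ "\<lambda>n. f n + g n"]) (auto intro: tendsto_add subspace_add[OF S])
next
  fix r x assume "x \<in> closure S"
  then obtain f where "\<forall>n. f n \<in> S" "f \<longlonglongrightarrow> x" unfolding closure_sequential by blast
  then show "r *\<^sub>R x \<in> closure S"
    unfolding closure_sequential
    by (intro exI[of _ "\<lambda>n. r *\<^sub>R f n"])
      (auto intro: tendsto_scaleR tendsto_const subspace_scale[OF S])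
qed

lemma parallelogram_midpoint:
  fixes x y z :: "'a::real_inner"
  shows "(norm (y - z))\<^sup>2 = 2 * (norm (x - y))\<^sup>2 + 2 * (norm (x - z))\<^sup>2
    - 4 * (norm (x - (1/2) *\<^sub>R (y + z)))\<^sup>2"
proof -
  have "norm (x - (1/2) *\<^sub>R (y + z)) = (1/2) * norm ((x - y) + (x - z))"
  proof -
    have "2 *\<^sub>R (x - (1/2) *\<^sub>R (y + z)) = 2 *\<^sub>R ((1/2) *\<^sub>R ((x - y) + (x - z)))"
      by (simp add: scaleR_right_diff_distrib scaleR_2)
    then have "x - (1/2) *\<^sub>R (y + z) = (1/2) *\<^sub>R ((x - y) + (x - z))"
      by (rule scaleR_left_imp_eq[rotated]) simp
    then show ?thesis by simp
  qed
  then have "4 * (norm (x - (1/2) *\<^sub>R (y + z)))\<^sup>2 = (norm ((x - y) + (x - z)))\<^sup>2"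
    by (simp only: power_mult_distrib) (simp add: power2_eq_square)
  moreover have "(norm (v - u))\<^sup>2 = 2 * (norm u)\<^sup>2 + 2 * (norm v)\<^sup>2 - (norm (u + v))\<^sup>2" for u v :: 'a
    by (simp add: power2_norm_eq_inner inner_diff_left inner_diff_right inner_add_left
        inner_add_right inner_commute[of v u])
  from this[of "x - z" "x - y"]
  have "(norm (y - z))\<^sup>2 = 2 * (norm (x - y))\<^sup>2 + 2 * (norm (x - z))\<^sup>2
      - (norm ((x - y) + (x - z)))\<^sup>2"
    by simp
  ultimately show ?thesis by simp
qed

text \<open>A minimizing sequence for the distance to \<open>L\<close> is Cauchy by the
  parallelogram law, and minimality of its limit gives orthogonality.\<close>

lemma projection_point_exists:
  fixes L :: "'a::{real_inner,complete_space} set"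
  assumes L: "subspace L" "closed L"
  obtains p where "p \<in> L" "\<And>y. y \<in> L \<Longrightarrow> (x - p) \<bullet> y = 0"
proof -
  define d where "d = (INF y\<in>L. (norm (x - y))\<^sup>2)"
  have bdd: "bdd_below ((\<lambda>y. (norm (x - y))\<^sup>2) ` L)" by (rule bdd_belowI2[where m = 0]) simp
  have ne: "L \<noteq> {}" using subspace_0[OF L(1)] by blast
  have d_le: "d \<le> (norm (x - y))\<^sup>2" if "y \<in> L" for y
    unfolding d_def by (rule cINF_lower[OF bdd that])
  have "\<exists>y\<in>L. (norm (x - y))\<^sup>2 < d + 1 / real (Suc n)" for n
    using cINF_less_iff[OF ne bdd, of "d + 1 / real (Suc n)"] by (simp add: d_def)
  then obtain y where y: "\<And>n. y n \<in> L" "\<And>n. (norm (x - y n))\<^sup>2 < d + 1 / real (Suc n)"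
    by metis
  have dist: "(norm (y m - y n))\<^sup>2 \<le> 2 / real (Suc m) + 2 / real (Suc n)" for m n
  proof -
    have "(norm (y m - y n))\<^sup>2 = 2 * (norm (x - y m))\<^sup>2 + 2 * (norm (x - y n))\<^sup>2
        - 4 * (norm (x - (1/2) *\<^sub>R (y m + y n)))\<^sup>2"
      by (rule parallelogram_midpoint)
    moreover have "d \<le> (norm (x - (1/2) *\<^sub>R (y m + y n)))\<^sup>2"
      using L(1) y(1) by (intro d_le subspace_scale subspace_add)
    ultimately show ?thesis using y(2)[of m] y(2)[of n] by simp
  qed
  have "Cauchy y"
  proof (rule CauchyI)
    fix e :: real assume "0 < e"
    then obtain M where "4 / e\<^sup>2 < real M" using reals_Archimedean2 by blast
    then have M: "4 / real (Suc M) < e\<^sup>2" using \<open>0 < e\<close> by (simp add: field_simps add_strict_increasing)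
    have "norm (y m - y n) < e" if "m \<ge> M" "n \<ge> M" for m n
    proof -
      have "2 / real (Suc m) \<le> 2 / real (Suc M)" "2 / real (Suc n) \<le> 2 / real (Suc M)"
        using that by (simp_all add: frac_le)
      then have "(norm (y m - y n))\<^sup>2 < e\<^sup>2" using dist[of m n] M by linarith
      then show ?thesis using \<open>0 < e\<close> by (simp add: power2_less_imp_less)
    qed
    then show "\<exists>M. \<forall>m\<ge>M. \<forall>n\<ge>M. norm (y m - y n) < e" by blast
  qed
  then obtain p where p: "y \<longlonglongrightarrow> p" using Cauchy_convergent_iff convergent_def by blast
  have pL: "p \<in> L" using closed_sequentially[OF L(2) y(1) p] .
  have "(\<lambda>n. (norm (x - y n))\<^sup>2) \<longlonglongrightarrow> (norm (x - p))\<^sup>2" by (intro tendsto_intros p)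
  moreover have "(\<lambda>n. d + 1 / real (Suc n)) \<longlonglongrightarrow> d + 0"
    by (intro tendsto_add tendsto_const LIMSEQ_Suc lim_1_over_n)
  ultimately have "(norm (x - p))\<^sup>2 \<le> d + 0"
    by (rule LIMSEQ_le) (intro exI allI impI less_imp_le y(2))
  then have p_le: "(norm (x - p))\<^sup>2 \<le> d" by simp
  have "(x - p) \<bullet> z = 0" if "z \<in> L" for z
  proof (cases "z = 0")
    case False
    \<comment> \<open>The coefficient for which \<open>r *\<^sub>R z\<close> is closest to
      \<open>x - p\<close>.\<close>
    define r where "r = ((x - p) \<bullet> z) / (z \<bullet> z)"
    have "p + r *\<^sub>R z \<in> L" using L(1) pL that by (intro subspace_add subspace_scale)
    from order_trans[OF p_le d_le[OF this]] have "(norm (x - p))\<^sup>2 \<le> (norm ((x - p) - r *\<^sub>R z))\<^sup>2"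
      by (simp only: diff_diff_add)
    also have "\<dots> = (norm (x - p))\<^sup>2 - 2 * r * ((x - p) \<bullet> z) + r\<^sup>2 * (z \<bullet> z)"
      unfolding power2_norm_eq_inner inner_diff_left[of "x - p"] inner_diff_right[of _ "x - p"]
      by (simp only: inner_commute[of z "x - p"] inner_scaleR_left inner_scaleR_right)
        (simp add: power2_eq_square)
    finally have "((x - p) \<bullet> z)\<^sup>2 / (z \<bullet> z) \<le> 0"
      using False unfolding r_def by (simp add: power2_eq_square)
    then show ?thesis using False by (metis divide_pos_pos inner_gt_zero_iff not_less zero_less_power2)
  qed simp
  then show ?thesis using that pL by blast
qed

lemma projection_point_unique:
  assumes L: "subspace L" and "p \<in> L" "q \<in> L"
    and "\<And>y. y \<in> L \<Longrightarrow> (x - p) \<bullet> y = 0" "\<And>y. y \<in> L \<Longrightarrow> (x - q) \<bullet> y = 0"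
  shows "p = q"
proof -
  have "p - q \<in> L" using assms by (intro subspace_diff)
  then have "(x - q) \<bullet> (p - q) - (x - p) \<bullet> (p - q) = 0" using assms by simp
  then have "(p - q) \<bullet> (p - q) = 0" by (simp add: inner_diff_left)
  then show ?thesis by simp
qed

lemma projection_exists:
  fixes L :: "'a::{real_inner,complete_space} set"
  assumes L: "subspace L" "closed L"
  obtains P where "psd P" "\<And>x. P x \<in> L" "\<And>x y. y \<in> L \<Longrightarrow> (x - P x) \<bullet> y = 0"
    "\<And>x. x \<in> L \<Longrightarrow> P x = x"
proof -
  have "\<exists>p. p \<in> L \<and> (\<forall>y\<in>L. (x - p) \<bullet> y = 0)" for x
    using projection_point_exists[OF L, of x] by metis
  then obtain P where P: "\<And>x. P x \<in> L" "\<And>x y. y \<in> L \<Longrightarrow> (x - P x) \<bullet> y = 0" by metis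
  note uniq = projection_point_unique[OF L(1) P(1) _ P(2)]
  have inner_P: "P x \<bullet> P y = x \<bullet> P y" for x y
    using P(2)[OF P(1), of x y] by (simp add: inner_diff_left)
  have "psd P"
  proof (rule psdI)
    show "bounded_linear P"
    proof (rule bounded_linear_intro[where K = 1])
      show "P (x + y) = P x + P y" for x y
      proof (rule uniq)
        show "P x + P y \<in> L" by (intro subspace_add L P)
        show "(x + y - (P x + P y)) \<bullet> z = 0" if "z \<in> L" for z
          using P(2)[OF that, of x] P(2)[OF that, of y] by (simp add: algebra_simps inner_add_left)
      qed
      show "P (r *\<^sub>R x) = r *\<^sub>R P x" for r x
      proof (rule uniq)
        show "r *\<^sub>R P x \<in> L" by (intro subspace_scale L P)
        show "(r *\<^sub>R x - r *\<^sub>R P x) \<bullet> z = 0" if "z \<in> L" for z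
          using P(2)[OF that, of x] by (simp flip: scaleR_right_diff_distrib)
      qed
      show "norm (P x) \<le> norm x * 1" for x
      proof -
        have "norm (P x) * norm (P x) = x \<bullet> P x"
          using inner_P[of x x] by (simp add: power2_norm_eq_inner flip: power2_eq_square)
        also have "\<dots> \<le> norm x * norm (P x)" by (rule norm_cauchy_schwarz)
        finally show ?thesis by (cases "P x = 0") auto
      qed
    qed
    show "P x \<bullet> y = x \<bullet> P y" for x y
      using inner_P[of x y] inner_P[of y x] by (simp add: inner_commute)
    show "0 \<le> P x \<bullet> x" for x
      using inner_P[of x x] inner_ge_zero[of "P x"] by (simp add: inner_commute)
  qed
  moreover have "P x = x" if "x \<in> L" for x by (rule uniq) (auto simp: that)
  ultimately show ?thesis using that P by blast
qed

text \<open>Coercivity bounds \<open>Y\<close> from below, so \<open>Y\<close> is injective with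
  closed range. A vector orthogonal to the range has zero form and is therefore zero.\<close>

lemma psd_coercive_inverse:
  fixes Y :: "'a::{real_inner,complete_space} \<Rightarrow> 'a"
  assumes Y: "psd Y" and c: "0 < c" "\<And>x. c * (norm x)\<^sup>2 \<le> Y x \<bullet> x"
  obtains W where "psd W" "\<And>x. Y (W x) = x" "\<And>x. W (Y x) = x"
proof -
  note lin = psd_linear[OF Y]
  have below: "c * norm x \<le> norm (Y x)" for x
  proof (cases "x = 0")
    case False
    have "(c * norm x) * norm x \<le> norm (Y x) * norm x"
      using order_trans[OF c(2) norm_cauchy_schwarz[of "Y x" x]]
      by (simp add: power2_eq_square ac_simps)
    then show ?thesis using False by simp
  qed (simp add: linear_0[OF lin])
  have "complete (range Y)"
    using complete_isometric_image[OF c(1) subspace_UNIV psd_bounded_linear[OF Y]] below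
    by (simp add: complete_UNIV)
  then have closed: "closed (range Y)" by (rule complete_imp_closed)
  have sub: "subspace (range Y)" using linear_subspace_image[OF lin subspace_UNIV] .
  have inj: "inj Y"
    using below c(1) by (auto simp: linear_injective_0[OF lin])
      (metis mult_pos_pos norm_zero not_less zero_less_norm_iff)
  have "surj Y"
  proof -
    have "x \<in> range Y" for x
    proof -
      obtain p where p: "p \<in> range Y" "\<And>y. y \<in> range Y \<Longrightarrow> (x - p) \<bullet> y = 0"
        using projection_point_exists[OF sub closed] by blast
      have "Y (x - p) \<bullet> (x - p) = 0" using p(2)[of "Y (x - p)"] by (simp add: inner_commute)
      then have "c * (norm (x - p))\<^sup>2 \<le> 0" using c(2)[of "x - p"] by simp
      then have "x = p" using c(1) by (simp add: mult_le_0_iff)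
      then show "x \<in> range Y" using p(1) by simp
    qed
    then show ?thesis by blast
  qed
  define W where "W = inv Y"
  have YW: "Y (W x) = x" for x unfolding W_def by (rule surj_f_inv_f[OF \<open>surj Y\<close>])
  have WY: "W (Y x) = x" for x unfolding W_def by (rule inv_f_f[OF inj])
  have "psd W"
  proof (rule psdI)
    show "bounded_linear W"
    proof (rule bounded_linear_intro[where K = "1 / c"])
      show "W (x + y) = W x + W y" for x y
        using WY[of "W x + W y"] by (simp add: linear_add[OF lin] YW)
      show "W (r *\<^sub>R x) = r *\<^sub>R W x" for r x
        using WY[of "r *\<^sub>R W x"] by (simp add: linear_scale[OF lin] YW)
      show "norm (W x) \<le> norm x * (1 / c)" for x
        using below[of "W x"] c(1) by (simp add: YW field_simps)
    qed
    show "W x \<bullet> y = x \<bullet> W y" for x y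
      using psd_sym[OF Y, of "W x" "W y"] by (simp add: YW)
    show "0 \<le> W x \<bullet> x" for x
      using psd_nonneg[OF Y, of "W x"] by (simp add: YW inner_commute)
  qed
  then show ?thesis using that YW WY by blast
qed

section \<open>The iteration for commuting operators\<close>

text \<open>This is \<open>mu K X\<close> when \<open>X + K\<close> is invertible.\<close>

definition mu_inv :: "('a \<Rightarrow> 'a::real_inner) \<Rightarrow> ('a \<Rightarrow> 'a) \<Rightarrow> 'a \<Rightarrow> 'a"
  where "mu_inv K X = (\<lambda>x. X (inv (\<lambda>x. X x + K x) (X x)))"

text \<open>The bound \<open>c\<close> is a parameter because each iteration multiplies it by
  3/4.\<close>

locale coercive_pair =
  fixes K X :: "'a::{real_inner,complete_space} \<Rightarrow> 'a" and c :: real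
  assumes K: "psd K" and X: "psd X" and comm: "\<And>x. X (K x) = K (X x)"
    and c: "0 < c" "\<And>x. c * (norm x)\<^sup>2 \<le> X x \<bullet> x + K x \<bullet> x"
begin

definition W where "W = inv (\<lambda>x. X x + K x)"

lemma psd_W: "psd W"
  and W_right: "X (W x) + K (W x) = x"
  and W_left: "W (X x + K x) = x"
proof -
  obtain V where V: "psd V" "\<And>x. X (V x) + K (V x) = x" "\<And>x. V (X x + K x) = x"
    using psd_coercive_inverse[OF psd_add[OF X K] c(1)] c(2) by (metis inner_add_left)
  have "W = V" unfolding W_def
  proof (rule inv_equality)
    show "V (X x + K x) = x" "X (V x) + K (V x) = x" for x by (fact V)+
  qed
  then show "psd W" "X (W x) + K (W x) = x" "W (X x + K x) = x" using V by simp_all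
qed

lemma mu_inv_eq: "mu_inv K X x = X (W (X x))"
  by (simp add: mu_inv_def W_def)

lemma commute_W:
  assumes "linear R" "\<And>x. R (X x) = X (R x)" "\<And>x. R (K x) = K (R x)"
  shows "R (W x) = W (R x)"
proof -
  have "R x = X (R (W x)) + K (R (W x))"
    using W_right[of x] linear_add[OF assms(1), of "X (W x)" "K (W x)"] by (simp add: assms(2,3))
  then show ?thesis using W_left[of "R (W x)"] by simp
qed

lemma commute_mu_inv:
  assumes "linear R" "\<And>x. R (X x) = X (R x)" "\<And>x. R (K x) = K (R x)"
  shows "R (mu_inv K X x) = mu_inv K X (R x)"
  by (simp add: mu_inv_eq assms(2) commute_W[OF assms])

lemma W_X: "W (X x) = X (W x)" and W_K: "W (K x) = K (W x)"
  using commute_W[OF psd_linear[OF X], of x] commute_W[OF psd_linear[OF K], of x] comm by auto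

lemma psd_mu_inv: "psd (mu_inv K X)"
  unfolding mu_inv_eq by (rule psd_conj[OF psd_bounded_linear[OF X] psd_bounded_linear[OF X] psd_sym[OF X] psd_W])

text \<open>The left side is the expression minimized in the parallel sum of \<open>X\<close> and
  \<open>K\<close>. The minimizer is \<open>u = W (X v)\<close>, and the minimum is the form of
  \<open>X - mu_inv K X\<close>.\<close>

lemma complete_square:
  "X (v - u) \<bullet> (v - u) + K u \<bullet> u
    = X v \<bullet> v - mu_inv K X v \<bullet> v
      + (X (u - W (X v)) \<bullet> (u - W (X v)) + K (u - W (X v)) \<bullet> (u - W (X v)))"
proof -
  let ?w = "W (X v)"
  have eq: "X ?w \<bullet> z + K ?w \<bullet> z = X v \<bullet> z" for z
    using W_right[of "X v"] by (metis inner_add_left)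
  have "mu_inv K X v \<bullet> v = X v \<bullet> ?w"
    by (simp add: mu_inv_eq psd_sym[OF X] inner_commute)
  moreover have "X u \<bullet> ?w = X ?w \<bullet> u" "K u \<bullet> ?w = K ?w \<bullet> u" "X u \<bullet> v = X v \<bullet> u"
    using psd_sym[OF X] psd_sym[OF K] by (metis inner_commute)+
  ultimately show ?thesis
    using eq[of u] eq[of ?w]
    by (simp add: linear_diff[OF psd_linear[OF X]] linear_diff[OF psd_linear[OF K]]
        inner_diff_left inner_diff_right)
qed

lemma mu_inv_le: "mu_inv K X v \<bullet> v \<le> X v \<bullet> v"
  using complete_square[of v "W (X v)"] psd_nonneg[OF X, of "v - W (X v)"]
    psd_nonneg[OF K, of "W (X v)"]
  by (simp add: linear_0[OF psd_linear[OF X]] linear_0[OF psd_linear[OF K]])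

text \<open>A form of the recursion without inverses. It passes to the strong limit although the
  coercivity bounds tend to 0.\<close>

lemma mu_inv_square: "X (mu_inv K X x) + K (mu_inv K X x) = X (X x)"
  using W_right[of "X (X x)"] by (simp add: mu_inv_eq W_X)

lemma mu_inv_fixed: "K x = 0 \<Longrightarrow> X x = x \<Longrightarrow> mu_inv K X x = x"
  using W_left[of x] by (simp add: mu_inv_eq)

text \<open>With \<open>D = X - K\<close>, commutativity gives
  \<open>mu_inv K X + K = (3/4) (X + K) + (1/4) D (X + K)\<^sup>-\<^sup>1 D\<close>.\<close>

lemma coercive_mu_inv: "(3/4) * c * (norm x)\<^sup>2 \<le> mu_inv K X x \<bullet> x + K x \<bullet> x"
proof -
  define D where "D x = X x - K x" for x
  have D: "bounded_linear D"
    unfolding D_def by (intro bounded_linear_sub psd_bounded_linear X K)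
  have D_sym: "D x \<bullet> y = x \<bullet> D y" for x y
    by (simp add: D_def inner_diff_left inner_diff_right psd_sym[OF X] psd_sym[OF K])
  \<comment> \<open>These are X^2, XK and K^2 divided by X + K, applied to \<open>x\<close>. The
    identity above becomes p + q + r = (3/4)(p + 2q + r) + (1/4)(p - 2q + r).\<close>
  define p q r where "p = W (X (X x))" and "q = W (X (K x))" and "r = W (K (K x))"
  note lin = psd_linear[OF X] psd_linear[OF K] psd_linear[OF psd_W]
  have "mu_inv K X x = p" by (simp add: mu_inv_eq p_def W_X)
  moreover have Kx: "K x = q + r"
    using W_left[of "K x"] by (simp add: q_def r_def linear_add[OF lin(3)])
  moreover have Xx: "X x = p + q"
    using W_left[of "X x"] by (simp add: p_def q_def comm linear_add[OF lin(3)])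
  moreover have "D (W (D x)) = p - 2 *\<^sub>R q + r"
    by (simp add: D_def linear_diff[OF lin(1)] linear_diff[OF lin(2)] linear_diff[OF lin(3)]
        W_X W_K p_def q_def r_def comm scaleR_2)
  then have "D (W (D x)) \<bullet> x = p \<bullet> x - 2 * (q \<bullet> x) + r \<bullet> x"
    by (simp add: inner_add_left inner_diff_left)
  ultimately have "mu_inv K X x \<bullet> x + K x \<bullet> x
      = (3/4) * (X x \<bullet> x + K x \<bullet> x) + (1/4) * (D (W (D x)) \<bullet> x)"
    by (simp add: inner_add_left) (simp add: field_simps)
  moreover have "(3/4) * (c * (norm x)\<^sup>2) \<le> (3/4) * (X x \<bullet> x + K x \<bullet> x)"
    by (rule mult_left_mono[OF c(2)]) simp
  moreover have "0 \<le> (1/4) * (D (W (D x)) \<bullet> x)"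
    using psd_nonneg[OF psd_conj[OF D D D_sym psd_W], of x] by simp
  ultimately show ?thesis unfolding mult.assoc by linarith
qed

lemma coercive_pair_mu_inv: "coercive_pair K (mu_inv K X) ((3/4) * c)"
  using commute_mu_inv[OF psd_linear[OF K]] comm
  by unfold_locales (use K psd_mu_inv c(1) coercive_mu_inv in auto)

end

lemma coercive_pair_iterate:
  assumes "coercive_pair K X c"
  shows "coercive_pair K ((mu_inv K ^^ n) X) ((3/4) ^ n * c)"
proof (induction n)
  case (Suc n)
  from coercive_pair.coercive_pair_mu_inv[OF Suc] show ?case by (simp add: ac_simps)
qed (simp add: assms)

lemma iterate_commute:
  assumes "coercive_pair K X c" "linear R" "\<And>x. R (X x) = X (R x)" "\<And>x. R (K x) = K (R x)"
  shows "R ((mu_inv K ^^ n) X x) = (mu_inv K ^^ n) X (R x)"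
proof (induction n arbitrary: x)
  case (Suc n)
  from coercive_pair.commute_mu_inv[OF coercive_pair_iterate[OF assms(1)] assms(2) Suc assms(4)]
  show ?case by simp
qed (simp add: assms)

text \<open>The limit \<open>L\<close> satisfies \<open>(L + K) L = L\<^sup>2\<close>, hence \<open>K L = 0\<close>; since every iterate is the
  identity on the kernel of \<open>K\<close>, \<open>L\<close> is the orthogonal projection onto that kernel.\<close>

lemma iterate_limit:
  assumes pair: "coercive_pair K X c" and le: "\<And>x. X x \<bullet> x \<le> (norm x)\<^sup>2"
    and fixed: "\<And>x. K x = 0 \<Longrightarrow> X x = x"
  obtains L where "psd L" "\<And>x. (\<lambda>n. (mu_inv K ^^ n) X x) \<longlonglongrightarrow> L x" "\<And>x. K (L x) = 0"
    "\<And>x. K x = 0 \<Longrightarrow> L x = x"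
proof -
  define Xs where "Xs n = (mu_inv K ^^ n) X" for n
  have pairs: "coercive_pair K (Xs n) ((3/4) ^ n * c)" for n
    unfolding Xs_def by (rule coercive_pair_iterate[OF pair])
  have psd: "psd (Xs n)" for n using pairs by (rule coercive_pair.X)
  have step: "Xs (Suc n) = mu_inv K (Xs n)" for n by (simp add: Xs_def)
  have "Xs (Suc n) x \<bullet> x \<le> Xs n x \<bullet> x" for n x
    unfolding step by (rule coercive_pair.mu_inv_le[OF pairs])
  moreover have "Xs 0 x \<bullet> x \<le> (norm x)\<^sup>2" for x by (simp add: Xs_def le)
  ultimately obtain L where L: "psd L" "\<And>x. (\<lambda>n. Xs n x) \<longlonglongrightarrow> L x"
    "\<And>n x. Xs n x \<bullet> x \<le> (norm x)\<^sup>2"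
    using psd_limit[of Xs, OF psd] by blast
  note K = bounded_linear.tendsto[OF psd_bounded_linear[OF coercive_pair.K[OF pair]]]
  have "K (L x) = 0" for x
  proof -
    note comp = tendsto_contractions[OF psd_linear[OF psd] psd_contraction[OF psd L(3)] L(2)]
    have lim1: "(\<lambda>n. Xs n (Xs n x)) \<longlonglongrightarrow> L (L x)" by (rule comp[OF L(2)])
    have lim2: "(\<lambda>n. Xs n (Xs (Suc n) x) + K (Xs (Suc n) x)) \<longlonglongrightarrow> L (L x) + K (L x)"
      by (intro tendsto_add comp K LIMSEQ_Suc[OF L(2)])
    have "Xs n (Xs (Suc n) x) + K (Xs (Suc n) x) = Xs n (Xs n x)" for n
      unfolding step by (rule coercive_pair.mu_inv_square[OF pairs])
    with lim2 have "(\<lambda>n. Xs n (Xs n x)) \<longlonglongrightarrow> L (L x) + K (L x)" by simp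
    from LIMSEQ_unique[OF this lim1] show ?thesis by simp
  qed
  moreover have "L x = x" if "K x = 0" for x
  proof -
    have "Xs n x = x" for n
    proof (induction n)
      case 0
      show ?case using fixed[OF that] by (simp add: Xs_def)
    next
      case (Suc n)
      then show ?case
        unfolding step by (intro coercive_pair.mu_inv_fixed[OF pairs] that)
    qed
    then show ?thesis using LIMSEQ_unique[OF L(2)[of x]] by simp
  qed
  ultimately show ?thesis using that L unfolding Xs_def by blast
qed

section \<open>Complex structure\<close>

text \<open>The complex structure is reduced to one real isometry with square -1, through which
  complex scalars and the complex inner product are expressed.\<close>

lemma bounded_linear_ii: "bounded_linear (\<lambda>x::'a::complex_inner. \<i> *\<^sub>C x)"
  and inner_ii: "(\<i> *\<^sub>C x) \<bullet> (\<i> *\<^sub>C y) = x \<bullet> (y::'a)"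
  and ii_ii: "\<i> *\<^sub>C (\<i> *\<^sub>C x) = - (x::'a)"
  and scaleC_conv: "c *\<^sub>C x = Re c *\<^sub>R x + Im c *\<^sub>R (\<i> *\<^sub>C (x::'a))"
  and cinner_conv: "cinner x y = Complex (x \<bullet> y) (- ((\<i> *\<^sub>C x) \<bullet> (y::'a)))"
proof -
  show inner: "(\<i> *\<^sub>C x) \<bullet> (\<i> *\<^sub>C y) = x \<bullet> y" for x y :: 'a
  proof -
    have "cinner (\<i> *\<^sub>C x) (\<i> *\<^sub>C y) = \<i> * cnj (\<i> * cinner y x)"
      by (metis cinner_scaleC_left cinner_commute)
    also have "\<dots> = cinner x y" using cinner_commute[of x y] by simp
    finally show ?thesis by (simp flip: Re_cinner)
  qed
  have scale: "\<i> *\<^sub>C (r *\<^sub>R x) = r *\<^sub>R (\<i> *\<^sub>C x)" for r and x :: 'a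
    by (simp add: scaleC_scaleC mult.commute flip: scaleC_of_real)
  show "bounded_linear (\<lambda>x::'a. \<i> *\<^sub>C x)"
    by (rule bounded_linear_intro[where K = 1])
      (auto simp: scaleC_add_right scale norm_eq_sqrt_inner inner)
  show "\<i> *\<^sub>C (\<i> *\<^sub>C x) = - x"
    using scaleC_of_real[of "-1" x] by (simp add: scaleC_scaleC)
  have "c *\<^sub>C x = (complex_of_real (Re c) + complex_of_real (Im c) * \<i>) *\<^sub>C x"
    by (metis complex_eq mult.commute)
  then show "c *\<^sub>C x = Re c *\<^sub>R x + Im c *\<^sub>R (\<i> *\<^sub>C x)"
    by (simp only: scaleC_add_left scaleC_of_real flip: scaleC_scaleC)
  have "Re (\<i> * cinner x y) = (\<i> *\<^sub>C x) \<bullet> y"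
    by (metis cinner_scaleC_left Re_cinner)
  then show "cinner x y = Complex (x \<bullet> y) (- ((\<i> *\<^sub>C x) \<bullet> y))"
    by (intro complex_eqI) (auto simp: Re_cinner)
qed

lemma inner_ii_left: "(\<i> *\<^sub>C x) \<bullet> y = - (x \<bullet> (\<i> *\<^sub>C (y::'a::complex_inner)))"
  using inner_ii[of "\<i> *\<^sub>C x" y] by (simp add: ii_ii)

lemma qform_conv: "qform T x = T x \<bullet> x"
  by (simp add: qform_def Re_cinner)

text \<open>Commutation with \<open>\<i>\<close> carries symmetry over from the real part of the
  inner product to its imaginary part.\<close>

lemma pos_ops_iff: "T \<in> pos_ops \<longleftrightarrow> psd T \<and> (\<forall>x. T (\<i> *\<^sub>C x) = \<i> *\<^sub>C T x)"
proof
  assume "T \<in> pos_ops"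
  then have T: "bounded_clinear T" "\<And>x y. cinner (T x) y = cinner x (T y)" "\<And>x. 0 \<le> qform T x"
    by (auto simp: pos_ops_def)
  have "T x \<bullet> y = x \<bullet> T y" for x y using T(2)[of x y] by (metis Re_cinner)
  with T show "psd T \<and> (\<forall>x. T (\<i> *\<^sub>C x) = \<i> *\<^sub>C T x)"
    by (auto simp: psd_def bounded_clinear_def qform_conv)
next
  assume T: "psd T \<and> (\<forall>x. T (\<i> *\<^sub>C x) = \<i> *\<^sub>C T x)"
  then have lin: "linear T" by (simp add: psd_linear)
  have "T (c *\<^sub>C x) = c *\<^sub>C T x" for c x
    unfolding scaleC_conv[of c] linear_add[OF lin] linear_scale[OF lin] using T by simp
  moreover have "cinner (T x) y = cinner x (T y)" for x y
  proof -
    have "T x \<bullet> y = x \<bullet> T y" "(\<i> *\<^sub>C T x) \<bullet> y = (\<i> *\<^sub>C x) \<bullet> T y"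
      using psd_sym[of T] T by metis+
    then show ?thesis unfolding cinner_conv by simp
  qed
  ultimately show "T \<in> pos_ops"
    using T by (auto simp: pos_ops_def bounded_clinear_def qform_conv psd_def)
qed

lemma pos_ops_psd: "T \<in> pos_ops \<Longrightarrow> psd T"
  and pos_ops_ii: "T \<in> pos_ops \<Longrightarrow> T (\<i> *\<^sub>C x) = \<i> *\<^sub>C T x"
  by (auto simp: pos_ops_iff)

text \<open>The root commutes with all that commutes with \<open>T\<close>, in particular with
  \<open>\<i>\<close>, so it is complex linear. Any other root \<open>R\<close> commutes with
  \<open>T = R \<circ> R\<close>, hence with \<open>S\<close>, and \<open>psd_sqrt_unique\<close>
  applies.\<close>

lemma op_sqrt:
  fixes T :: "'a::complex_hilbert \<Rightarrow> 'a"
  assumes T: "T \<in> pos_ops"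
  shows op_sqrt_pos_ops: "op_sqrt T \<in> pos_ops"
    and op_sqrt_square: "op_sqrt T (op_sqrt T x) = T x"
proof -
  obtain S where S: "psd S" "\<And>x. S (S x) = T x"
    "\<And>R x. bounded_linear R \<Longrightarrow> (\<And>x. R (T x) = T (R x)) \<Longrightarrow> R (S x) = S (R x)"
    using psd_sqrt_exists[OF pos_ops_psd[OF T]] by blast
  have "\<exists>!S. S \<in> pos_ops \<and> S \<circ> S = T"
  proof (rule ex1I)
    show "S \<in> pos_ops \<and> S \<circ> S = T"
      using S(1,2) S(3)[OF bounded_linear_ii] pos_ops_ii[OF T] by (auto simp: pos_ops_iff)
    fix R assume R: "R \<in> pos_ops \<and> R \<circ> R = T"
    then have RR: "R (R x) = T x" for x by (metis comp_apply)
    have psd: "psd R" using R pos_ops_psd by blast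
    have "R (T x) = T (R x)" for x by (simp flip: RR)
    from S(3)[OF psd_bounded_linear[OF psd] this]
    show "R = S" by (intro psd_sqrt_unique S(1) psd) (auto simp: RR S(2))
  qed
  from theI'[OF this] have "op_sqrt T \<in> pos_ops" "op_sqrt T \<circ> op_sqrt T = T"
    unfolding op_sqrt_def by auto
  then show "op_sqrt T \<in> pos_ops" "op_sqrt T (op_sqrt T x) = T x"
    by (auto simp: fun_eq_iff)
qed

lemma psd_eqI:
  assumes T: "psd T" and U: "psd U" and eq: "\<And>x. T x \<bullet> x = U x \<bullet> x"
  shows "T = U"
proof
  fix x
  have "psd (\<lambda>x. T x - U x)" by (rule psd_diff[OF T U]) (simp add: eq)
  from psd_eq_0[OF this, of x] show "T x = U x" by (simp add: inner_diff_left eq)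
qed

text \<open>A positive operator is determined by its form, so the definite description has a unique
  solution.\<close>

lemma parallel_sum_eqI:
  assumes T: "T \<in> pos_ops" and form: "\<And>h. qform T h = Inf {qform X f + qform G g | f g. h = f + g}"
  shows "parallel_sum X G = T"
  unfolding parallel_sum_def
proof (rule the_equality)
  show "T \<in> pos_ops \<and> (\<forall>h. qform T h = Inf {qform X f + qform G g | f g. h = f + g})"
    using assms by blast
  fix U assume U: "U \<in> pos_ops \<and> (\<forall>h. qform U h = Inf {qform X f + qform G g | f g. h = f + g})"
  show "U = T"
  proof (rule psd_eqI)
    show "U x \<bullet> x = T x \<bullet> x" for x
      unfolding qform_conv[symmetric] form using U by blast
  qed (use U T pos_ops_psd in blast)+
qed

text \<open>On a set stable under \<open>\<i>\<close> real orthogonality already implies complex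
  orthogonality, and orthogonality is a closed condition.\<close>

lemma orth_complement_closure_iff:
  assumes D: "\<And>g. g \<in> D \<Longrightarrow> \<i> *\<^sub>C g \<in> D"
  shows "x \<in> orth_complement (closure D) \<longleftrightarrow> (\<forall>g\<in>D. x \<bullet> g = 0)"
proof
  assume "x \<in> orth_complement (closure D)"
  then show "\<forall>g\<in>D. x \<bullet> g = 0"
    using subsetD[OF closure_subset, of _ D] unfolding orth_complement_def
    by (auto simp: Re_cinner[symmetric])
next
  assume x: "\<forall>g\<in>D. x \<bullet> g = 0"
  have "closed {g. x \<bullet> g = 0 \<and> (\<i> *\<^sub>C x) \<bullet> g = 0}"
    by (intro closed_Collect_conj closed_Collect_eq continuous_intros)
  moreover have "D \<subseteq> {g. x \<bullet> g = 0 \<and> (\<i> *\<^sub>C x) \<bullet> g = 0}"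
    using x D by (auto simp: inner_ii_left)
  ultimately have "closure D \<subseteq> {g. x \<bullet> g = 0 \<and> (\<i> *\<^sub>C x) \<bullet> g = 0}"
    by (rule closure_minimal[rotated])
  then show "x \<in> orth_complement (closure D)"
    by (auto simp: orth_complement_def cinner_conv zero_complex.code)
qed

lemma orth_proj_eqI:
  assumes D: "\<And>g. g \<in> D \<Longrightarrow> \<i> *\<^sub>C g \<in> D"
    and N: "N = orth_complement (closure D)"
    and y: "y \<in> N" "\<And>m. m \<in> N \<Longrightarrow> (x - y) \<bullet> m = 0"
  shows "orth_proj N x = y"
  unfolding orth_proj_def
proof (rule the_equality)
  note iff = orth_complement_closure_iff[OF D, folded N]
  have N_ii: "\<i> *\<^sub>C m \<in> N" if "m \<in> N" for m
    using that D by (auto simp: iff inner_ii_left)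
  have "cinner (x - y) m = 0" if "m \<in> N" for m
    using y(2)[OF that] y(2)[OF N_ii[OF that]]
    by (simp add: cinner_conv inner_ii_left zero_complex.code)
  then show "y \<in> N \<and> x - y \<in> orth_complement N" by (simp add: y(1) orth_complement_def)
  fix z assume z: "z \<in> N \<and> x - z \<in> orth_complement N"
  have zy: "z - y \<in> N" using z y(1) by (simp add: iff inner_diff_left)
  have "(x - z) \<bullet> (z - y) = 0"
    using z zy by (auto simp: orth_complement_def simp flip: Re_cinner)
  with y(2)[OF zy] have "(z - y) \<bullet> (z - y) = 0"
    by (simp add: inner_diff_left)
  then show "z = y" by simp
qed

section \<open>The representation over the graph space\<close>

text \<open>\<open>T\<close> and \<open>S\<close> are the roots of \<open>F0 + t G\<close> and
  \<open>G\<close>, and \<open>dominates\<close> expresses positivity of \<open>F0\<close>. Keeping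
  \<open>t\<close> free lets one construction yield both formulas.\<close>

locale graph_pair =
  fixes T S :: "'a::complex_hilbert \<Rightarrow> 'a" and t :: real
  assumes T: "T \<in> pos_ops" and S: "S \<in> pos_ops" and t: "0 \<le> t"
    and dominates: "\<And>h. t * (norm (S h))\<^sup>2 \<le> (norm (T h))\<^sup>2"
begin

definition J :: "'a \<Rightarrow> 'a \<times> 'a" where "J h = (T h, S h)"
definition J' :: "'a \<times> 'a \<Rightarrow> 'a" where "J' v = T (fst v) + S (snd v)"
definition L where "L = closure (range J)"
definition P where "P = (SOME P. psd P \<and> (\<forall>x. P x \<in> L) \<and> (\<forall>x. \<forall>y\<in>L. (x - P x) \<bullet> y = 0)
  \<and> (\<forall>x\<in>L. P x = x))"
text \<open>The compression to \<open>L\<close> is realised on all of H x H and vanishes on the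
  complement of \<open>L\<close>, so that every operator lives on one type.\<close>

definition K where "K v = P (0, snd (P v))"
definition X0 where "X0 v = v - (1 + t) *\<^sub>R K v"
definition D where "D = {f. T f \<in> range S}"

lemmas psd_T = pos_ops_psd[OF T] and psd_S = pos_ops_psd[OF S]

lemma bounded_linear_J: "bounded_linear J"
  unfolding J_def by (intro bounded_linear_Pair psd_bounded_linear psd_T psd_S)

lemma bounded_linear_J': "bounded_linear J'"
  unfolding J'_def
  by (intro bounded_linear_add bounded_linear_compose[OF psd_bounded_linear[OF psd_T]]
      bounded_linear_compose[OF psd_bounded_linear[OF psd_S]] bounded_linear_fst bounded_linear_snd)

lemma J_adjoint: "J h \<bullet> v = h \<bullet> J' v"
  by (simp add: J_def J'_def inner_prod_def psd_sym[OF psd_T] psd_sym[OF psd_S] inner_add_right)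

lemma subspace_L: "subspace L" and closed_L: "closed L" and J_in_L: "J h \<in> L"
proof -
  have "subspace (range J)"
    by (rule linear_subspace_image[OF bounded_linear.linear[OF bounded_linear_J] subspace_UNIV])
  then show "subspace L" unfolding L_def by (rule subspace_closure)
  show "closed L" "J h \<in> L" by (auto simp: L_def intro: subsetD[OF closure_subset])
qed

lemma psd_P: "psd P" and P_in: "P v \<in> L" and P_orth: "w \<in> L \<Longrightarrow> (v - P v) \<bullet> w = 0"
  and P_id: "w \<in> L \<Longrightarrow> P w = w"
proof -
  have "\<exists>P. psd P \<and> (\<forall>x. P x \<in> L) \<and> (\<forall>x. \<forall>y\<in>L. (x - P x) \<bullet> y = 0) \<and> (\<forall>x\<in>L. P x = x)"
    using projection_exists[OF subspace_L closed_L] by metis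
  from someI_ex[OF this, folded P_def]
  show "psd P" "P v \<in> L" "w \<in> L \<Longrightarrow> (v - P v) \<bullet> w = 0" "w \<in> L \<Longrightarrow> P w = w"
    by blast+
qed

lemma psd_K: "psd K"
proof -
  have "psd (\<lambda>v::'a \<times> 'a. (0, snd v))"
    by (rule psdI)
      (auto simp: inner_prod_def intro: bounded_linear_Pair bounded_linear_zero bounded_linear_snd)
  from psd_conj[OF psd_bounded_linear[OF psd_P] psd_bounded_linear[OF psd_P] psd_sym[OF psd_P] this]
  show ?thesis unfolding K_def[abs_def] .
qed

lemma K_form: "K v \<bullet> v = (norm (snd (P v)))\<^sup>2"
  unfolding K_def psd_sym[OF psd_P] by (simp add: inner_prod_def power2_norm_eq_inner)

text \<open>On the range of \<open>J\<close> this is \<open>dominates\<close>; the condition is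
  closed, so it extends to \<open>L\<close>.\<close>

lemma norm_snd_L:
  assumes "v \<in> L"
  shows "(1 + t) * (norm (snd v))\<^sup>2 \<le> (norm v)\<^sup>2"
proof -
  have "closed {v::'a \<times> 'a. (1 + t) * (norm (snd v))\<^sup>2 \<le> (norm v)\<^sup>2}"
    by (intro closed_Collect_le continuous_intros)
  moreover have "range J \<subseteq> {v. (1 + t) * (norm (snd v))\<^sup>2 \<le> (norm v)\<^sup>2}"
  proof -
    have "(1 + t) * (norm (S h))\<^sup>2 \<le> (norm (J h))\<^sup>2" for h
      using dominates[of h] by (simp add: J_def norm_Pair distrib_right)
    then show ?thesis by (auto simp: J_def)
  qed
  ultimately show ?thesis using assms closure_minimal unfolding L_def by blast
qed

lemma K_le: "(1 + t) * (K v \<bullet> v) \<le> (norm v)\<^sup>2"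
proof -
  have "(1 + t) * (K v \<bullet> v) \<le> (norm (P v))\<^sup>2"
    unfolding K_form by (rule norm_snd_L[OF P_in])
  also have "\<dots> \<le> (norm v)\<^sup>2"
  proof -
    have "(norm (P v))\<^sup>2 = v \<bullet> P v"
      using P_orth[OF P_in, of v v] by (simp add: power2_norm_eq_inner inner_diff_left)
    also have "\<dots> \<le> norm v * norm (P v)" by (rule norm_cauchy_schwarz)
    finally have "norm (P v) \<le> norm v"
      by (cases "P v = 0") (auto simp: power2_eq_square)
    then show ?thesis by (simp add: power_mono)
  qed
  finally show ?thesis .
qed

text \<open>Here \<open>X0 + K = 1 - t K\<close>, and \<open>K_le\<close> bounds \<open>K\<close> by
  1 / (1 + t).\<close>

lemma coercive_X0: "coercive_pair K X0 (1 / (1 + t))"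
proof
  show "psd X0"
    unfolding X0_def
    by (intro psd_diff psd_id psd_scaleR psd_K) (use t K_le in \<open>auto simp: power2_norm_eq_inner\<close>)
  show "X0 (K v) = K (X0 v)" for v
    by (simp add: X0_def linear_diff[OF psd_linear[OF psd_K]] linear_scale[OF psd_linear[OF psd_K]])
  show "1 / (1 + t) * (norm v)\<^sup>2 \<le> X0 v \<bullet> v + K v \<bullet> v" for v
  proof -
    have "t / (1 + t) * ((1 + t) * (K v \<bullet> v)) \<le> t / (1 + t) * (norm v)\<^sup>2"
      using t by (intro mult_left_mono K_le) simp
    moreover have "t / (1 + t) * ((1 + t) * (K v \<bullet> v)) = t * (K v \<bullet> v)"
      using t by simp
    moreover have "1 / (1 + t) * (norm v)\<^sup>2 = (norm v)\<^sup>2 - t / (1 + t) * (norm v)\<^sup>2"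
      using t by (simp add: field_simps)
    moreover have "X0 v \<bullet> v + K v \<bullet> v = (norm v)\<^sup>2 - t * (K v \<bullet> v)"
      by (simp add: X0_def inner_diff_left power2_norm_eq_inner distrib_right)
    ultimately show ?thesis by linarith
  qed
qed (use psd_K t in auto)

definition X where "X n = (mu_inv K ^^ n) X0"
definition c where "c n = (3/4) ^ n * (1 / (1 + t))"

lemma pair: "coercive_pair K (X n) (c n)"
  unfolding X_def c_def by (rule coercive_pair_iterate[OF coercive_X0])

lemma psd_X: "psd (X n)"
  by (rule coercive_pair.X[OF pair])

lemma X_Suc: "X (Suc n) = mu_inv K (X n)"
  by (simp add: X_def)

lemma X_commute:
  assumes R: "linear R" "\<And>v. R (K v) = K (R v)"
  shows "R (X n v) = X n (R v)"
  unfolding X_def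
  by (rule iterate_commute[OF coercive_X0 R(1) _ R(2)])
    (simp add: X0_def linear_diff[OF R(1)] linear_scale[OF R(1)] R(2))

lemma P_K: "P (K v) = K (P v)"
  by (simp add: K_def P_id[OF P_in])

lemma X_in_L: "v \<in> L \<Longrightarrow> X n v \<in> L"
  using X_commute[OF psd_linear[OF psd_P] P_K, of n v] P_in[of "X n v"] by (simp add: P_id)

section \<open>Compatibility with the complex structure\<close>

definition I :: "'a \<times> 'a \<Rightarrow> 'a \<times> 'a" where "I v = (\<i> *\<^sub>C fst v, \<i> *\<^sub>C snd v)"

lemma bounded_linear_I: "bounded_linear I"
  unfolding I_def
  by (intro bounded_linear_Pair bounded_linear_compose[OF bounded_linear_ii]
      bounded_linear_fst bounded_linear_snd)

lemma I_J: "I (J h) = J (\<i> *\<^sub>C h)"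
  by (simp add: I_def J_def pos_ops_ii[OF T] pos_ops_ii[OF S])

lemma J'_I: "J' (I v) = \<i> *\<^sub>C J' v"
  by (simp add: I_def J'_def pos_ops_ii[OF T] pos_ops_ii[OF S] scaleC_add_right)

lemma I_in_L: "v \<in> L \<Longrightarrow> I v \<in> L"
  using closure_bounded_linear_image_subset[OF bounded_linear_I, of "range J"]
    closure_mono[of "I ` range J" "range J"] I_J
  by (auto simp: L_def image_subset_iff)

text \<open>\<open>I\<close> is skew-symmetric and preserves \<open>L\<close>, so
  \<open>I (P v)\<close> has the defining properties of the projection of
  \<open>I v\<close>.\<close>

lemma P_I: "P (I v) = I (P v)"
proof (rule projection_point_unique[OF subspace_L P_in _ P_orth])
  show "I (P v) \<in> L" by (rule I_in_L[OF P_in])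
  fix w assume "w \<in> L"
  have "(I v - I (P v)) \<bullet> w = - ((v - P v) \<bullet> I w)"
    by (simp add: I_def inner_prod_def inner_ii_left inner_diff_left)
  then show "(I v - I (P v)) \<bullet> w = 0" using P_orth[OF I_in_L[OF \<open>w \<in> L\<close>]] by simp
qed

lemma I_K: "I (K v) = K (I v)"
proof -
  have "I (0, snd (P v)) = (0, snd (P (I v)))"
    using linear_0[OF bounded_linear.linear[OF bounded_linear_ii]] by (simp add: P_I) (simp add: I_def)
  then show ?thesis by (simp add: K_def flip: P_I)
qed

lemma I_X: "I (X n v) = X n (I v)"
  by (rule X_commute[OF bounded_linear.linear[OF bounded_linear_I] I_K])

section \<open>The iterates as operators on H\<close>

definition iter where "iter n h = J' (X n (J h))"

lemma iter_inner: "iter n h \<bullet> f = X n (J h) \<bullet> J f"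
  by (simp add: iter_def inner_commute[of _ f] inner_commute[of _ "J f"] J_adjoint)

lemma iter_0: "iter 0 h = T (T h) - t *\<^sub>R S (S h)"
proof -
  \<comment> \<open>\<open>v - P v\<close> is orthogonal to the range of \<open>J\<close>, that is,
    it lies in the kernel of the adjoint \<open>J'\<close>.\<close>
  have J'_P: "J' (P v) = J' v" for v
  proof -
    have "(J' v - J' (P v)) \<bullet> h = (v - P v) \<bullet> J h" for h
      by (simp add: inner_diff_left inner_commute[of _ h] inner_commute[of _ "J h"] J_adjoint
          linear_diff[OF bounded_linear.linear[OF bounded_linear_J']])
    then have "(J' v - J' (P v)) \<bullet> (J' v - J' (P v)) = 0" by (simp add: P_orth J_in_L)
    then show ?thesis by simp
  qed
  note lin = bounded_linear.linear[OF bounded_linear_J']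
  have "J' (K (J h)) = S (S h)"
    by (simp add: K_def J'_P P_id[OF J_in_L]) (simp add: J_def J'_def linear_0[OF psd_linear[OF psd_T]])
  moreover have "J' (J h) = T (T h) + S (S h)" by (simp add: J_def J'_def)
  ultimately show ?thesis
    by (simp add: iter_def X_def X0_def linear_diff[OF lin] linear_scale[OF lin])
      (simp add: scaleR_left_distrib)
qed

text \<open>Under \<open>J\<close> the forms of \<open>iter n\<close> and \<open>S\<^sup>2\<close>
  become those of \<open>X n\<close> and \<open>K\<close>, so the infimum is that of a completed
  square over the range of \<open>J\<close>. The minimizer \<open>w\<close> lies in the closure of
  this range, so the square contributes nothing to the infimum.\<close>

lemma parallel_sum_iter:
  "parallel_sum (iter n) (\<lambda>h. S (S h)) = (\<lambda>h. iter n h - iter (Suc n) h)"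
proof (rule parallel_sum_eqI)
  note lin = bounded_linear.linear[OF bounded_linear_J']
  have eq: "iter n h - iter (Suc n) h = J' (X n (J h) - X (Suc n) (J h))" for h
    by (simp add: iter_def linear_diff[OF lin])
  have "psd (\<lambda>v. X n v - X (Suc n) v)"
    unfolding X_Suc by (intro psd_diff psd_X coercive_pair.psd_mu_inv[OF pair]
        coercive_pair.mu_inv_le[OF pair])
  from psd_conj[OF bounded_linear_J bounded_linear_J' J_adjoint this]
  show "(\<lambda>h. iter n h - iter (Suc n) h) \<in> pos_ops"
    unfolding pos_ops_iff eq
    by (auto simp: linear_diff[OF lin] linear_diff[OF bounded_linear.linear[OF bounded_linear_ii]]
        simp flip: I_J I_X J'_I)
  fix h
  let ?v = "J h"
  define w where "w = coercive_pair.W K (X n) (X n ?v)"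
  let ?Y = "\<lambda>v. X n v \<bullet> v + K v \<bullet> v"
  let ?d = "X n ?v \<bullet> ?v - X (Suc n) ?v \<bullet> ?v"
  let ?A = "{qform (iter n) f + qform (\<lambda>h. S (S h)) g | f g. h = f + g}"
  have value_eq: "qform (iter n) (h - g) + qform (\<lambda>h. S (S h)) g = ?d + ?Y (J g - w)" for g
  proof -
    have "qform (\<lambda>h. S (S h)) g = K (J g) \<bullet> J g"
      by (simp add: qform_conv K_form P_id[OF J_in_L])
        (simp add: J_def psd_sym[OF psd_S] power2_norm_eq_inner)
    moreover have "qform (iter n) (h - g) = X n (?v - J g) \<bullet> (?v - J g)"
      by (simp add: qform_conv iter_inner linear_diff[OF bounded_linear.linear[OF bounded_linear_J]])
    ultimately show ?thesis
      using coercive_pair.complete_square[OF pair, of n ?v "J g"] by (simp add: X_Suc w_def)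
  qed
  have A: "?A = range (\<lambda>g. ?d + ?Y (J g - w))"
  proof -
    have "?A = range (\<lambda>g. qform (iter n) (h - g) + qform (\<lambda>h. S (S h)) g)"
      by (auto simp: image_iff) (metis add_diff_cancel_right', metis diff_add_cancel)
    then show ?thesis by (simp only: value_eq)
  qed
  \<comment> \<open>\<open>P\<close> commutes with \<open>K\<close> and \<open>X n\<close>, hence
    with the inverse defining \<open>w\<close>.\<close>
  have "w \<in> L"
  proof -
    have "P w = coercive_pair.W K (X n) (P (X n ?v))"
      unfolding w_def
      by (rule coercive_pair.commute_W[OF pair psd_linear[OF psd_P] X_commute[OF psd_linear[OF psd_P] P_K] P_K])
    also have "\<dots> = w" by (simp add: w_def P_id X_in_L J_in_L)
    finally show ?thesis using P_in[of w] by simp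
  qed
  then obtain f where f: "\<forall>k. f k \<in> range J" "f \<longlonglongrightarrow> w"
    unfolding L_def closure_sequential by blast
  define g where "g k = inv J (f k)" for k
  have "J (g k) = f k" for k
    unfolding g_def using f(1) by (intro f_inv_into_f) blast
  with f(2) have g: "(\<lambda>k. J (g k)) \<longlonglongrightarrow> w" by simp
  have "Inf ?A = ?d"
  proof (rule cInf_eq_non_empty)
    show "?A \<noteq> {}" unfolding A by blast
    show "?d \<le> a" if "a \<in> ?A" for a
    proof -
      from that obtain g where "a = ?d + ?Y (J g - w)" unfolding A by blast
      then show ?thesis
        using psd_nonneg[OF psd_X, of n "J g - w"] psd_nonneg[OF psd_K, of "J g - w"] by simp
    qed
    fix b assume b: "\<And>a. a \<in> ?A \<Longrightarrow> b \<le> a"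
    have "(\<lambda>k. J (g k) - w) \<longlonglongrightarrow> 0" using g by (simp add: LIM_zero)
    then have "(\<lambda>k. ?d + ?Y (J (g k) - w)) \<longlonglongrightarrow> ?d + ?Y 0"
      by (intro tendsto_intros bounded_linear.tendsto[OF psd_bounded_linear[OF psd_X]]
          bounded_linear.tendsto[OF psd_bounded_linear[OF psd_K]])
    moreover have "b \<le> ?d + ?Y (J (g k) - w)" for k
      by (rule b) (unfold A, blast)
    ultimately have "b \<le> ?d + ?Y 0" by (intro LIMSEQ_le_const) auto
    then show "b \<le> ?d" by simp
  qed
  then show "qform (\<lambda>h. iter n h - iter (Suc n) h) h = Inf ?A"
    by (simp add: qform_conv inner_diff_left iter_inner)
qed

lemma mu_iter: "mu (\<lambda>h. S (S h)) (iter n) = iter (Suc n)"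
  by (simp add: mu_def parallel_sum_iter)

section \<open>Identification of the limit\<close>

lemma D_ii: "g \<in> D \<Longrightarrow> \<i> *\<^sub>C g \<in> D"
  unfolding D_def by (auto simp: pos_ops_ii[OF T] simp flip: pos_ops_ii[OF S])

text \<open>The orthogonal complement of the graph space \<open>L\<close> consists of the pairs \<open>(a, b)\<close> with
  \<open>T a + S b = 0\<close>, so its first components are exactly the elements of \<open>D\<close>.\<close>

lemma orth_complement_D_iff: "y \<in> orth_complement (closure D) \<longleftrightarrow> (y, 0) \<in> L"
proof -
  have "y \<bullet> g = 0" if "(y, 0) \<in> L" "g \<in> D" for g
  proof -
    obtain z where z: "T g = S z" using \<open>g \<in> D\<close> by (auto simp: D_def)
    \<comment> \<open>Since \<open>T g = S z\<close>, the pair \<open>(g, - z)\<close> is in the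
      kernel of \<open>J'\<close> and hence orthogonal to \<open>L\<close>.\<close>
    have "closed {v. v \<bullet> (g, - z) = 0}"
      by (intro closed_Collect_eq continuous_intros)
    moreover have "J h \<bullet> (g, - z) = 0" for h
      by (simp add: J_adjoint) (simp add: J'_def z linear_neg[OF psd_linear[OF psd_S]])
    ultimately have "L \<subseteq> {v. v \<bullet> (g, - z) = 0}"
      unfolding L_def by (intro closure_minimal) auto
    with that(1) show ?thesis by (auto simp: inner_prod_def)
  qed
  moreover have "(y, 0) \<in> L" if y: "\<forall>g\<in>D. y \<bullet> g = 0"
  proof -
    \<comment> \<open>The component of \<open>(y, 0)\<close> orthogonal to \<open>L\<close>. Its
      entry \<open>a\<close> lies in \<open>D\<close>, so the squared norm of the component, which
      equals the inner product of \<open>a\<close> and \<open>y\<close>, is 0.\<close>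
    obtain a b where ab: "(y, 0) - P (y, 0) = (a, b)" by fastforce
    have "J' (a, b) \<bullet> J' (a, b) = 0"
      using P_orth[OF J_in_L, of "(y, 0)" "J' (a, b)"]
      by (simp add: ab inner_commute[of "(a, b)"] J_adjoint)
    then have "T a = S (- b)"
      by (simp add: J'_def linear_neg[OF psd_linear[OF psd_S]] eq_neg_iff_add_eq_0)
    then have "a \<in> D" by (auto simp: D_def)
    have "((y, 0) - P (y, 0)) \<bullet> ((y, 0) - P (y, 0)) = (a, b) \<bullet> (y, 0)"
      using P_orth[OF P_in, of "(y, 0)" "(y, 0)"] by (simp add: inner_diff_right flip: ab)
    also have "\<dots> = 0" using y \<open>a \<in> D\<close> by (simp add: inner_commute)
    finally have "(y, 0) = P (y, 0)" by simp
    then show ?thesis using P_in by metis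
  qed
  moreover have "y \<in> orth_complement (closure D) \<longleftrightarrow> (\<forall>g\<in>D. y \<bullet> g = 0)"
    by (rule orth_complement_closure_iff) (rule D_ii)
  ultimately show ?thesis by blast
qed

text \<open>\<open>Q\<close> projects onto the kernel of \<open>K\<close>, and
  \<open>Q (J h)\<close> stays in \<open>L\<close>, so it has the form \<open>(y, 0)\<close>.
  Testing against the other pairs \<open>(m, 0)\<close> in \<open>L\<close> shows that
  \<open>y\<close> is the projection of \<open>T h\<close>.\<close>

lemma iter_limit: "(\<lambda>n. iter n h) \<longlonglongrightarrow> T (orth_proj (orth_complement (closure D)) (T h))"
proof -
  have "X0 v \<bullet> v \<le> (norm v)\<^sup>2" for v
    using t psd_nonneg[OF psd_K, of v] by (simp add: X0_def inner_diff_left power2_norm_eq_inner)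
  moreover have "X0 v = v" if "K v = 0" for v using that by (simp add: X0_def)
  ultimately obtain Q where Q: "psd Q" "\<And>v. (\<lambda>n. X n v) \<longlonglongrightarrow> Q v" "\<And>v. K (Q v) = 0"
    "\<And>v. K v = 0 \<Longrightarrow> Q v = v"
    using iterate_limit[OF coercive_X0] unfolding X_def by blast
  have QL: "Q (J h) \<in> L"
    by (rule closed_sequentially[OF closed_L X_in_L[OF J_in_L] Q(2)])
  have "snd (Q (J h)) = 0"
    using K_form[of "Q (J h)"] by (simp add: Q(3) P_id[OF QL])
  then obtain y where y: "Q (J h) = (y, 0)" by (metis prod.collapse)
  have "orth_proj (orth_complement (closure D)) (T h) = y"
  proof (rule orth_proj_eqI[OF D_ii refl])
    show "y \<in> orth_complement (closure D)" using QL by (simp add: orth_complement_D_iff y)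
    fix m assume "m \<in> orth_complement (closure D)"
    then have mL: "(m, 0) \<in> L" by (simp add: orth_complement_D_iff)
    then have "K (m, 0) = 0"
      using linear_0[OF psd_linear[OF psd_P]] by (simp add: K_def P_id zero_prod_def)
    then have "Q (J h) \<bullet> (m, 0) = J h \<bullet> (m, 0)" by (simp add: psd_sym[OF Q(1)] Q(4))
    then show "(T h - y) \<bullet> m = 0" unfolding y by (simp add: J_def inner_diff_left)
  qed
  moreover have "(\<lambda>n. iter n h) \<longlonglongrightarrow> J' (Q (J h))"
    unfolding iter_def by (rule bounded_linear.tendsto[OF bounded_linear_J' Q(2)])
  ultimately show ?thesis
    by (simp add: y J'_def linear_0[OF psd_linear[OF psd_S]])
qed

lemma strong_lim_eq:
  assumes "Fs 0 = (\<lambda>h. T (T h) - t *\<^sub>R S (S h))"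
    and "\<And>n. Fs (Suc n) = mu (\<lambda>h. S (S h)) (Fs n)"
  shows "strong_lim Fs = T \<circ> orth_proj (orth_complement (closure {f. T f \<in> range S})) \<circ> T"
proof -
  have "Fs n = iter n" for n
    by (induction n) (auto simp: assms mu_iter iter_0)
  then show ?thesis
    using limI[OF iter_limit] by (auto simp: strong_lim_def D_def)
qed

end

section \<open>The two formulas for the limit\<close>

theorem theorem2p3:
  fixes G F0 F :: "'a::complex_hilbert \<Rightarrow> 'a"
    and Fs :: "nat \<Rightarrow> 'a \<Rightarrow> 'a"
    and M N :: "'a set"
  assumes "G \<in> pos_ops" and "F0 \<in> pos_ops"
    and "Fs 0 = F0"
    and "\<And>n. n \<ge> 1 \<Longrightarrow> Fs n = mu G (Fs (n - 1))"
    and "F = strong_lim Fs"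
    and "M = orth_complement (closure {f. op_sqrt (\<lambda>x. G x + F0 x) f \<in> range (op_sqrt G)})"
    and "N = orth_complement (closure {g. op_sqrt F0 g \<in> range (op_sqrt G)})"
  shows "F = op_sqrt (\<lambda>x. G x + F0 x) \<circ> orth_proj M \<circ> op_sqrt (\<lambda>x. G x + F0 x)
       \<and> F = op_sqrt F0 \<circ> orth_proj N \<circ> op_sqrt F0"
proof -
  have step: "Fs (Suc n) = mu G (Fs n)" for n using assms(4)[of "Suc n"] by simp
  define S where "S = op_sqrt G"
  have S: "S \<in> pos_ops" "(\<lambda>h. S (S h)) = G"
    using op_sqrt[OF assms(1)] by (auto simp: S_def)
  have norm_square: "(norm (R h))\<^sup>2 = R (R h) \<bullet> h" if "R \<in> pos_ops" for R and h :: 'a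
    using psd_sym[OF pos_ops_psd[OF that]] by (simp add: power2_norm_eq_inner)
  have sum: "(\<lambda>x. G x + F0 x) \<in> pos_ops"
    using assms(1,2) by (auto simp: pos_ops_iff psd_add scaleC_add_right)
  have SS: "S (S h) = G h" for h using S(2) by metis
  have nonneg: "0 \<le> F0 h \<bullet> h" for h using psd_nonneg[OF pos_ops_psd[OF assms(2)]] .
  \<comment> \<open>With \<open>t = 1\<close> the domination condition reads G \<le> G + F0; for
    \<open>B\<close> below, with \<open>t = 0\<close>, it is trivial.\<close>
  interpret A: graph_pair "op_sqrt (\<lambda>x. G x + F0 x)" S 1
    by unfold_locales
      (auto simp: op_sqrt_pos_ops[OF sum] S(1) norm_square SS op_sqrt_square[OF sum]
        inner_add_left nonneg)
  interpret B: graph_pair "op_sqrt F0" S 0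
    by unfold_locales (auto simp: op_sqrt_pos_ops[OF assms(2)] S(1))
  have "strong_lim Fs = op_sqrt (\<lambda>x. G x + F0 x) \<circ> orth_proj M \<circ> op_sqrt (\<lambda>x. G x + F0 x)"
    unfolding assms(6) S_def[symmetric]
    by (rule A.strong_lim_eq) (auto simp: assms(3) step S(2) SS op_sqrt_square[OF sum])
  moreover have "strong_lim Fs = op_sqrt F0 \<circ> orth_proj N \<circ> op_sqrt F0"
    unfolding assms(7) S_def[symmetric]
    by (rule B.strong_lim_eq) (auto simp: assms(3) step S(2) SS op_sqrt_square[OF assms(2)])
  ultimately show ?thesis unfolding assms(5) by blast
qed

end
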